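(* Let $t_0\ge0$, $m\ge1$, and let $a,g,b_k,h_k:[0,\infty)\to\mathbb R$ ($k=1,\dots,m$) be Lebesgue measurable functions such that $a,b_k$ are essentially bounded on $[0,\infty)$; $\operatorname{ess\,sup}_{t\ge t_0}|a(t)|\le a_0$ for some constant $a_0<1$; $b_k(t)\ge0$ for $t\ge t_0$; $0\le t-g(t)\le\delta$ and $0\le t-h_k(t)\le\tau_k$ with constants $\delta,\tau_k$; and the set $g^{-1}(E)$ has Lebesgue measure zero whenever $E\subset\mathbb R$ has Lebesgue measure zero. Suppose there exist $\beta>0$ and a set of indexes $J\subseteq\{1,\dots,m\}$ such that $b(t):=\sum_{k\in J}b_k(t)\ge\beta$ for $t\ge t_0$ and $$\left(\left\|\frac ab\right\|+\sum_{k\in J}\tau_k\left\|\frac{b_k}{b}\right\|\right)\frac{\sum_{k=1}^m\|b_k\|}{1-\|a\|}+\sum_{k\notin J}\left\|\frac{b_k}{b}\right\|<1.$$ Then the equation $\dot x(t)-a(t)\dot x(g(t))=-\sum_{k=1}^m b_k(t)x(h_k(t))$ is exponentially stable.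
   Context: Notation: $\|f\|=\|f\|_{[t_0,\infty)}=\operatorname{ess\,sup}_{t\ge t_0}|f(t)|$. Solutions: for an initial point $\sigma\ge t_0$ and bounded Borel measurable functions $\varphi:(-\infty,\sigma]\to\mathbb R$, $\psi:(-\infty,\sigma)\to\mathbb R$ (prescribed independently of each other), a solution of the equation with initial conditions $x(t)=\varphi(t)$ for $t\le\sigma$, $\dot x(t)=\psi(t)$ for $t<\sigma$ is a function $x$ that is absolutely continuous on each $[\sigma,c]$, has locally essentially bounded derivative on $[\sigma,\infty)$, and satisfies the equation for almost all $t\ge\sigma$, where $x$ at arguments $\le\sigma$ is replaced by $\varphi$ and $\dot x$ at arguments $<\sigma$ is replaced by $\psi$. The equation is (uniformly) exponentially stable if there exist $M>0$, $\gamma>0$, not depending on $\sigma\ge t_0$, $\varphi$, $\psi$, such that every such solution satisfies $|x(t)|\le M e^{-\gamma(t-\sigma)}\sup_{s\le\sigma}(|\varphi(s)|+|\psi(s)|)$ for $t\ge\sigma$ (with $\psi(\sigma):=0$). *)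

theory Defs
  imports "HOL-Probability.Essential_Supremum"
begin

text \<open>
  The value is an extended real, so that \<open>\<infinity>\<close> is not confused with a finite norm.
  Since \<open>esssup\<close> is \<open>\<infinity>\<close> for non-measurable functions, finiteness includes
  Lebesgue measurability on \<open>A\<close>.
\<close>

definition ess_norm :: "real set \<Rightarrow> (real \<Rightarrow> real) \<Rightarrow> ereal" where
  "ess_norm A f = esssup (lebesgue_on A) (\<lambda>t. ereal \<bar>f t\<bar>)"

text \<open>
  The usual definition with finite families of non-overlapping compact intervals, which are
  encoded as divisions of their union.
\<close>

definition abs_continuous_on_interval :: "real \<Rightarrow> real \<Rightarrow> (real \<Rightarrow> real) \<Rightarrow> bool" where
  "abs_continuous_on_interval u v f \<longleftrightarrow>
     (\<forall>\<epsilon>>0. \<exists>\<eta>>0. \<forall>\<D>. \<D> division_of \<Union>\<D> \<longrightarrow> \<Union>\<D> \<subseteq> {u..v} \<longrightarrow>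
        (\<Sum>K\<in>\<D>. Sup K - Inf K) < \<eta> \<longrightarrow> (\<Sum>K\<in>\<D>. \<bar>f (Sup K) - f (Inf K)\<bar>) < \<epsilon>)"

definition admissible_initial_data ::
    "real \<Rightarrow> (real \<Rightarrow> real) \<Rightarrow> (real \<Rightarrow> real) \<Rightarrow> bool" where
  "admissible_initial_data \<sigma> \<phi> \<psi> \<longleftrightarrow>
     \<phi> \<in> borel_measurable (restrict_space borel {..\<sigma>}) \<and> bounded (\<phi> ` {..\<sigma>}) \<and>
     \<psi> \<in> borel_measurable (restrict_space borel {..<\<sigma>}) \<and> bounded (\<psi> ` {..<\<sigma>})"

text \<open>
  Solutions of
  \<open>x'(t) - a(t) x'(g(t)) = - (\<Sum>k=1..m. b\<^sub>k(t) x(h\<^sub>k(t)))\<close> started at \<open>\<sigma>\<close>.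
  Only the restriction of \<open>x\<close> to \<open>[\<sigma>, \<infinity>)\<close> matters: earlier values are read off
  from \<open>\<phi>\<close> and \<open>\<psi>\<close>.  The value of \<open>deriv x\<close> at points where \<open>x\<close> is not
  differentiable, and at \<open>\<sigma>\<close>, is arbitrary; these points form a null set, and so does their
  preimage under \<open>g\<close> whenever \<open>g\<close> pulls null sets back to null sets.
\<close>

definition is_solution ::
    "nat \<Rightarrow> (real \<Rightarrow> real) \<Rightarrow> (real \<Rightarrow> real) \<Rightarrow> (nat \<Rightarrow> real \<Rightarrow> real) \<Rightarrow> (nat \<Rightarrow> real \<Rightarrow> real) \<Rightarrow>
     real \<Rightarrow> (real \<Rightarrow> real) \<Rightarrow> (real \<Rightarrow> real) \<Rightarrow> (real \<Rightarrow> real) \<Rightarrow> bool" where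
  "is_solution m a g b h \<sigma> \<phi> \<psi> x \<longleftrightarrow>
     x \<sigma> = \<phi> \<sigma> \<and>
     (\<forall>c\<ge>\<sigma>. abs_continuous_on_interval \<sigma> c x) \<and>
     (AE t in lebesgue_on {\<sigma>..}. x differentiable (at t)) \<and>
     (\<forall>c\<ge>\<sigma>. ess_norm {\<sigma>..c} (deriv x) < \<infinity>) \<and>
     (AE t in lebesgue_on {\<sigma>..}.
        deriv x t - a t * (if g t < \<sigma> then \<psi> (g t) else deriv x (g t)) =
        - (\<Sum>k = 1..m. b k t * (if h k t \<le> \<sigma> then \<phi> (h k t) else x (h k t))))"

definition exponentially_stable ::
    "real \<Rightarrow> nat \<Rightarrow> (real \<Rightarrow> real) \<Rightarrow> (real \<Rightarrow> real) \<Rightarrow> (nat \<Rightarrow> real \<Rightarrow> real) \<Rightarrow> (nat \<Rightarrow> real \<Rightarrow> real) \<Rightarrow>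
     bool" where
  "exponentially_stable t0 m a g b h \<longleftrightarrow>
     (\<exists>M>0. \<exists>\<gamma>>0. \<forall>\<sigma>\<ge>t0. \<forall>\<phi> \<psi> x.
        admissible_initial_data \<sigma> \<phi> \<psi> \<longrightarrow> is_solution m a g b h \<sigma> \<phi> \<psi> x \<longrightarrow>
        (\<forall>t\<ge>\<sigma>. \<bar>x t\<bar> \<le> M * exp (- \<gamma> * (t - \<sigma>)) *
           (SUP s\<in>{..\<sigma>}. \<bar>\<phi> s\<bar> + (if s < \<sigma> then \<bar>\<psi> s\<bar> else 0))))"

end

theory Submission
  imports Defs
begin

text \<open>
  Everything is measured against the weight \<open>e t = exp (- \<gamma> * (t - \<sigma>))\<close>.  Let \<open>P\<close> and \<open>q\<close> be the best
  constants with \<open>\<bar>x\<bar> \<le> P e\<close> and \<open>\<bar>x'\<bar> \<le> q e\<close> a.e. on \<open>[\<sigma>, T]\<close>, and let \<open>N\<close> bound the initial data.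
  The equation itself gives \<open>q \<le> \<parallel>a\<parallel> q + (\<Sum>k. \<parallel>b\<^sub>k\<parallel>) P + O(N)\<close>, hence a bound of \<open>q\<close> by
  \<open>(\<Sum>k. \<parallel>b\<^sub>k\<parallel>) / (1 - \<parallel>a\<parallel>) P + O(N)\<close>, up to factors that tend to 1 as \<open>\<gamma>\<close> tends to 0.
  Written as \<open>x' + B x = a x'(g) + (\<Sum>k\<in>J. b\<^sub>k (x - x(h\<^sub>k))) - (\<Sum>k\<notin>J. b\<^sub>k x(h\<^sub>k))\<close>, the equation has a
  right-hand side of size at most \<open>B r e\<close>, where \<open>r\<close> is linear in \<open>q\<close>, \<open>P\<close> and \<open>N\<close>; comparing \<open>x\<close> with a
  multiple of \<open>e\<close> gives \<open>P \<le> N + r / (1 - \<gamma> / \<beta>)\<close>.  Altogether \<open>P \<le> \<theta> P + C N\<close>, where \<open>\<theta>\<close> tends to the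
  left-hand side of the stability condition as \<open>\<gamma>\<close> tends to 0 and so is less than 1 for small \<open>\<gamma>\<close>.
  Neither constant depends on \<open>T\<close> or \<open>\<sigma>\<close>.
\<close>

section \<open>Absolutely continuous functions\<close>

lemma AE_lebesgue_on_iff:
  "S \<in> sets lebesgue \<Longrightarrow>
    (AE t in lebesgue_on S. P t) \<longleftrightarrow> (AE t in lebesgue. t \<in> S \<longrightarrow> P t)"
  by (rule AE_restrict_space_iff) simp

section \<open>Elementary properties of absolute continuity\<close>

lemma abs_continuous_on_interval_subinterval:
  assumes "abs_continuous_on_interval u v f" "u \<le> u'" "v' \<le> v"
  shows "abs_continuous_on_interval u' v' f"
proof -
  have "{u'..v'} \<subseteq> {u..v}" using assms by auto
  then show ?thesis
    using assms(1) unfolding abs_continuous_on_interval_def by (meson order_trans)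
qed

lemma abs_continuous_on_interval_uminus:
  assumes "abs_continuous_on_interval u v f"
  shows "abs_continuous_on_interval u v (\<lambda>t. - f t)"
  using assms unfolding abs_continuous_on_interval_def
  by (simp add: abs_minus_commute)

lemma abs_continuous_on_interval_diff:
  assumes f: "abs_continuous_on_interval u v f" and w: "abs_continuous_on_interval u v w"
  shows "abs_continuous_on_interval u v (\<lambda>t. f t - w t)"
  unfolding abs_continuous_on_interval_def
proof (intro allI impI)
  fix \<epsilon> :: real assume "\<epsilon> > 0"
  then have e2: "\<epsilon>/2 > 0" by simp
  obtain \<eta>1 where 1: "\<eta>1 > 0" "\<And>\<D>. \<D> division_of \<Union>\<D> \<Longrightarrow> \<Union>\<D> \<subseteq> {u..v} \<Longrightarrow>
        (\<Sum>K\<in>\<D>. Sup K - Inf K) < \<eta>1 \<Longrightarrow> (\<Sum>K\<in>\<D>. \<bar>f (Sup K) - f (Inf K)\<bar>) < \<epsilon>/2"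
    using f e2 unfolding abs_continuous_on_interval_def by meson
  obtain \<eta>2 where 2: "\<eta>2 > 0" "\<And>\<D>. \<D> division_of \<Union>\<D> \<Longrightarrow> \<Union>\<D> \<subseteq> {u..v} \<Longrightarrow>
        (\<Sum>K\<in>\<D>. Sup K - Inf K) < \<eta>2 \<Longrightarrow> (\<Sum>K\<in>\<D>. \<bar>w (Sup K) - w (Inf K)\<bar>) < \<epsilon>/2"
    using w e2 unfolding abs_continuous_on_interval_def by meson
  show "\<exists>\<eta>>0. \<forall>\<D>. \<D> division_of \<Union>\<D> \<longrightarrow> \<Union>\<D> \<subseteq> {u..v} \<longrightarrow> (\<Sum>K\<in>\<D>. Sup K - Inf K) < \<eta> \<longrightarrow>
        (\<Sum>K\<in>\<D>. \<bar>f (Sup K) - w (Sup K) - (f (Inf K) - w (Inf K))\<bar>) < \<epsilon>"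
  proof (intro exI[of _ "min \<eta>1 \<eta>2"] conjI allI impI)
    fix \<D> assume D: "\<D> division_of \<Union>\<D>" "\<Union>\<D> \<subseteq> {u..v}" "(\<Sum>K\<in>\<D>. Sup K - Inf K) < min \<eta>1 \<eta>2"
    have "(\<Sum>K\<in>\<D>. \<bar>f (Sup K) - w (Sup K) - (f (Inf K) - w (Inf K))\<bar>)
        \<le> (\<Sum>K\<in>\<D>. \<bar>f (Sup K) - f (Inf K)\<bar> + \<bar>w (Sup K) - w (Inf K)\<bar>)"
      by (rule sum_mono) linarith
    also have "\<dots> < \<epsilon>" using 1(2)[OF D(1,2)] 2(2)[OF D(1,2)] D(3) by (simp add: sum.distrib)
    finally show "(\<Sum>K\<in>\<D>. \<bar>f (Sup K) - w (Sup K) - (f (Inf K) - w (Inf K))\<bar>) < \<epsilon>" .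
  qed (use 1 2 in auto)
qed

text \<open>Members of a division are nonempty compact intervals, so \<open>Inf\<close> and
  \<open>Sup\<close> recover their endpoints; this ties the encoding by divisions to the usual sums
  over intervals.\<close>

lemma division_member_real:
  fixes K :: "real set"
  assumes "\<D> division_of S" "K \<in> \<D>"
  shows "K = {Inf K..Sup K}" "Inf K \<le> Sup K" "Inf K \<in> K" "Sup K \<in> K"
proof -
  obtain c d where K: "K = cbox c d" "K \<noteq> {}" using division_ofD(3,4)[OF assms(1)] assms(2) by metis
  then have "c \<le> d" "K = {c..d}" by auto
  then show "K = {Inf K..Sup K}" "Inf K \<le> Sup K" "Inf K \<in> K" "Sup K \<in> K" by auto
qed

lemma lipschitz_abs_continuous_on_interval:
  assumes "\<And>s t. u \<le> s \<Longrightarrow> s \<le> t \<Longrightarrow> t \<le> v \<Longrightarrow> \<bar>f t - f s\<bar> \<le> L * (t - s)"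
  shows "abs_continuous_on_interval u v f"
  unfolding abs_continuous_on_interval_def
proof (intro allI impI)
  fix \<epsilon> :: real assume e: "\<epsilon> > 0"
  show "\<exists>\<eta>>0. \<forall>\<D>. \<D> division_of \<Union>\<D> \<longrightarrow> \<Union>\<D> \<subseteq> {u..v} \<longrightarrow> (\<Sum>K\<in>\<D>. Sup K - Inf K) < \<eta> \<longrightarrow>
        (\<Sum>K\<in>\<D>. \<bar>f (Sup K) - f (Inf K)\<bar>) < \<epsilon>"
  \<comment> \<open>No sign is assumed for \<open>L\<close>; \<open>\<bar>L\<bar> + 1\<close> is
    positive in any case.\<close>
  proof (intro exI[of _ "\<epsilon> / (\<bar>L\<bar> + 1)"] conjI allI impI)
    show "\<epsilon> / (\<bar>L\<bar> + 1) > 0" using e by simp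
    fix \<D> assume D: "\<D> division_of \<Union>\<D>" "\<Union>\<D> \<subseteq> {u..v}" "(\<Sum>K\<in>\<D>. Sup K - Inf K) < \<epsilon> / (\<bar>L\<bar> + 1)"
    have "(\<Sum>K\<in>\<D>. \<bar>f (Sup K) - f (Inf K)\<bar>) \<le> (\<Sum>K\<in>\<D>. (\<bar>L\<bar> + 1) * (Sup K - Inf K))"
    proof (rule sum_mono)
      fix K assume K: "K \<in> \<D>"
      note d = division_member_real[OF D(1) K]
      have "\<bar>f (Sup K) - f (Inf K)\<bar> \<le> L * (Sup K - Inf K)"
        using d(2-4) D(2) K by (intro assms) (auto dest!: subsetD[OF Union_upper[OF K]])
      also have "\<dots> \<le> (\<bar>L\<bar> + 1) * (Sup K - Inf K)"
        using d(2) by (intro mult_right_mono) auto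
      finally show "\<bar>f (Sup K) - f (Inf K)\<bar> \<le> (\<bar>L\<bar> + 1) * (Sup K - Inf K)" .
    qed
    also have "\<dots> = (\<bar>L\<bar> + 1) * (\<Sum>K\<in>\<D>. Sup K - Inf K)" by (simp add: sum_distrib_left)
    also have "\<dots> < \<epsilon>" using D(3) by (simp add: field_simps add_pos_nonneg)
    finally show "(\<Sum>K\<in>\<D>. \<bar>f (Sup K) - f (Inf K)\<bar>) < \<epsilon>" .
  qed
qed

lemma abs_continuous_on_interval_imp_continuous_on:
  assumes "abs_continuous_on_interval u v f"
  shows "continuous_on {u..v} f"
  unfolding continuous_on_iff
proof (intro ballI allI impI)
  fix x and \<epsilon> :: real assume x: "x \<in> {u..v}" and e: "\<epsilon> > 0"
  obtain \<eta> where eta: "\<eta> > 0" "\<And>\<D>. \<D> division_of \<Union>\<D> \<Longrightarrow> \<Union>\<D> \<subseteq> {u..v} \<Longrightarrow>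
        (\<Sum>K\<in>\<D>. Sup K - Inf K) < \<eta> \<Longrightarrow> (\<Sum>K\<in>\<D>. \<bar>f (Sup K) - f (Inf K)\<bar>) < \<epsilon>"
    using assms e unfolding abs_continuous_on_interval_def by meson
  have *: "\<bar>f t - f s\<bar> < \<epsilon>" if "u \<le> s" "s \<le> t" "t \<le> v" "t - s < \<eta>" for s t
  proof -
    \<comment> \<open>A single interval is a division of itself, so absolute continuity controls
      each single increment.\<close>
    show ?thesis using eta(2)[of "{{s..t}}"] that division_of_self[of s t] by simp
  qed
  show "\<exists>d>0. \<forall>x'\<in>{u..v}. dist x' x < d \<longrightarrow> dist (f x') (f x) < \<epsilon>"
  proof (intro exI[of _ \<eta>] conjI ballI impI)
    fix y assume y: "y \<in> {u..v}" "dist y x < \<eta>"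
    show "dist (f y) (f x) < \<epsilon>"
    proof (cases "x \<le> y")
      case True then show ?thesis using *[of x y] x y by (simp add: dist_real_def)
    next
      case False then show ?thesis using *[of y x] x y by (simp add: dist_real_def abs_minus_commute)
    qed
  qed (fact eta(1))
qed

section \<open>Monotonicity and mean value estimates from derivative bounds that hold almost
  everywhere\<close>

lemma sum_length_division_le:
  fixes U :: "real set"
  assumes D: "\<D> division_of \<Union>\<D>" and U: "\<Union>\<D> \<subseteq> U" "U \<in> lmeasurable"
  shows "(\<Sum>K\<in>\<D>. Sup K - Inf K) \<le> measure lebesgue U"
proof -
  have fin: "finite \<D>" using D by auto
  have m: "K \<in> lmeasurable \<and> measure lebesgue K = Sup K - Inf K" if K: "K \<in> \<D>" for K
  proof -
    obtain l r where "K = {l..r}" "l \<le> r"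
      using division_member_real(1,2)[OF D K] by metis
    then show ?thesis by simp
  qed
  \<comment> \<open>Two members have disjoint interiors, so their intersection is convex with empty
    interior and hence negligible. The lengths therefore add up to the measure of the union.\<close>
  have neg: "pairwise (\<lambda>S T. negligible (S \<inter> T)) \<D>"
  proof (rule pairwiseI)
    fix S T assume ST: "S \<in> \<D>" "T \<in> \<D>" "S \<noteq> T"
    have "interior S \<inter> interior T = {}" using division_ofD(5)[OF D ST] .
    moreover obtain l r l' r' where "S = cbox l r" "T = cbox l' r'"
      using division_ofD(4)[OF D] ST by metis
    ultimately have "interior (S \<inter> T) = {}" "convex (S \<inter> T)"
      by (auto simp: convex_Int)
    then show "negligible (S \<inter> T)" by (simp add: negligible_convex_interior)
  qed
  have "(\<Sum>K\<in>\<D>. Sup K - Inf K) = (\<Sum>K\<in>\<D>. measure lebesgue K)"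
    using m by (intro sum.cong) auto
  also have "\<dots> = measure lebesgue (\<Union>\<D>)"
    using m by (intro measure_negligible_finite_Union[symmetric] fin neg) auto
  also have "\<dots> \<le> measure lebesgue U"
    using m fin U by (intro measure_mono_fmeasurable) auto
  finally show ?thesis .
qed

text \<open>
  Off the exceptional null set the increment over a small interval is controlled by the derivative
  at its tag; the intervals tagged in the null set lie in an open set of small measure, where
  absolute continuity applies.
\<close>

lemma abs_continuous_AE_deriv_nonpos_imp_le:
  assumes ac: "abs_continuous_on_interval u v f" and uv: "u \<le> v"
    and ae: "AE t in lebesgue. t \<in> {u<..v} \<longrightarrow> (\<exists>D\<le>0. (f has_real_derivative D) (at t))"
  shows "f v \<le> f u"
proof -
  obtain N0 where N0:
    "\<And>t. t \<in> space lebesgue - N0 \<Longrightarrow> t \<in> {u<..v} \<longrightarrow> (\<exists>D\<le>0. (f has_real_derivative D) (at t))"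
    "N0 \<in> null_sets lebesgue"
    by (rule AE_E3[OF ae], rule that, assumption+)
  \<comment> \<open>The derivative hypothesis leaves out \<open>u\<close>, which therefore joins the
    exceptional set.\<close>
  define N where "N = {u} \<union> N0"
  have N: "N \<in> null_sets lebesgue"
    unfolding N_def using N0(2) by (intro null_sets.Un) auto
  have der: "\<exists>D\<le>0. (f has_real_derivative D) (at t)" if "t \<in> {u..v}" "t \<notin> N" for t
  proof -
    have "t \<in> {u<..v}" "t \<notin> N0" using that by (auto simp: N_def)
    then show ?thesis using N0(1)[of t] by simp
  qed
  have "f v - f u \<le> \<epsilon>" if e: "\<epsilon> > 0" for \<epsilon>
  proof -
    \<comment> \<open>The summand 1 keeps the denominator positive when \<open>u = v\<close>; slopes
      up to \<open>\<epsilon>1\<close> contribute at most \<open>\<epsilon> / 2\<close> over the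
      whole interval.\<close>
    define \<epsilon>1 where "\<epsilon>1 = \<epsilon> / 2 / (v - u + 1)"
    have e1: "\<epsilon>1 > 0" "\<epsilon>1 * (v - u) \<le> \<epsilon> / 2" 
      using e uv by (auto simp: \<epsilon>1_def field_simps)
    obtain \<eta> where eta: "\<eta> > 0" "\<And>\<D>. \<D> division_of \<Union>\<D> \<Longrightarrow> \<Union>\<D> \<subseteq> {u..v} \<Longrightarrow>
        (\<Sum>K\<in>\<D>. Sup K - Inf K) < \<eta> \<Longrightarrow> (\<Sum>K\<in>\<D>. \<bar>f (Sup K) - f (Inf K)\<bar>) < \<epsilon> / 2"
      using ac e unfolding abs_continuous_on_interval_def by (meson half_gt_zero)
    obtain U where U: "open U" "N \<subseteq> U" "U - N \<in> lmeasurable" "emeasure lebesgue (U - N) < ennreal \<eta>"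
      using sets_lebesgue_outer_open[of N \<eta>] N eta(1) by blast
    have Um: "U \<in> lmeasurable" "measure lebesgue U < \<eta>"
    proof -
      have "emeasure lebesgue U = emeasure lebesgue (U - N)"
        using N U(1) by (simp add: emeasure_Diff_null_set borel_open)
      moreover have "U \<in> sets lebesgue" using U(1) by (simp add: borel_open)
      ultimately show "U \<in> lmeasurable" "measure lebesgue U < \<eta>"
        using U(4) eta(1) fmeasurableD2[OF U(3)]
        by (auto simp: fmeasurable_def measure_def less_top enn2real_less_iff)
    qed
    \<comment> \<open>The estimate is kept separate for the two sides of \<open>t\<close>, so that
      both can be added on an interval that contains its tag.\<close>
    have "\<exists>d>0. t \<in> {u..v} - N \<longrightarrow> (\<forall>y. \<bar>y - t\<bar> < d \<longrightarrow>
        (y \<ge> t \<longrightarrow> f y - f t \<le> \<epsilon>1 * (y - t)) \<and> (y \<le> t \<longrightarrow> f t - f y \<le> \<epsilon>1 * (t - y)))" for t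
    proof (cases "t \<in> {u..v} - N")
      case True
      then obtain D where D: "D \<le> 0" "(f has_real_derivative D) (at t)" using der by auto
      then have "(f has_derivative (*) D) (at t)" by (simp add: has_field_derivative_def)
      then obtain d where d: "d > 0" "\<And>y. \<bar>y - t\<bar> < d \<Longrightarrow> \<bar>f y - f t - D * (y - t)\<bar> \<le> \<epsilon>1 * \<bar>y - t\<bar>"
        using e1(1) unfolding has_derivative_at_alt by (auto simp: real_norm_def)
      show ?thesis
      proof (intro exI[of _ d] conjI impI allI)
        fix y assume y: "\<bar>y - t\<bar> < d" "t \<le> y"
        have "D * (y - t) \<le> 0" using D y by (simp add: mult_nonpos_nonneg)
        then show "f y - f t \<le> \<epsilon>1 * (y - t)" using d(2)[OF y(1)] y(2) by simp
      next
        fix y assume y: "\<bar>y - t\<bar> < d" "y \<le> t"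
        have "D * (y - t) \<ge> 0" using D y by (simp add: mult_nonpos_nonpos)
        then show "f t - f y \<le> \<epsilon>1 * (t - y)" using d(2)[OF y(1)] y(2) by simp
      qed (fact d(1))
    qed (auto intro: exI[of _ 1])
    then obtain d where d: "\<And>t. d t > 0"
      "\<And>t y. t \<in> {u..v} - N \<Longrightarrow> \<bar>y - t\<bar> < d t \<Longrightarrow> y \<ge> t \<Longrightarrow> f y - f t \<le> \<epsilon>1 * (y - t)"
      "\<And>t y. t \<in> {u..v} - N \<Longrightarrow> \<bar>y - t\<bar> < d t \<Longrightarrow> y \<le> t \<Longrightarrow> f t - f y \<le> \<epsilon>1 * (t - y)"
      by metis
    \<comment> \<open>Around a tag in \<open>N\<close> the gauge is all of \<open>U\<close>, which
      forces the intervals with such tags to have total length below \<open>\<eta>\<close>. Around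
      any other tag of the division it is a ball where the slope estimate holds.\<close>
    define G where "G t = (if t \<in> N then U else ball t (d t))" for t
    have "gauge G" unfolding gauge_def G_def using U d(1) by auto
    then obtain p where p: "p tagged_division_of {u..v}" "G fine p"
      by (rule fine_division_exists_real)
    have mem: "Inf K \<in> K \<and> Sup K \<in> K \<and> Inf K \<le> x \<and> x \<le> Sup K \<and> K \<subseteq> {u..v} \<and> K \<subseteq> G x \<and> x \<in> {u..v}"
      if xK: "(x, K) \<in> p" for x K
    proof -
      have "K \<in> snd ` p" using xK by force
      note dm = division_member_real[OF division_of_tagged_division[OF p(1)] this]
      have "x \<in> K" "K \<subseteq> {u..v}" using tagged_division_ofD(2,3)[OF p(1) xK] by auto
      moreover from this have "Inf K \<le> x" "x \<le> Sup K"
        by (auto intro!: cInf_lower cSup_upper intro: bdd_below_mono bdd_above_mono)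
      ultimately show ?thesis using dm(3,4) fineD[OF p(2) xK] by auto
    qed
    define p1 where "p1 = {(x, K) \<in> p. x \<in> N}"
    have finp: "finite p" using p(1) by blast
    have p1: "p1 \<subseteq> p" by (auto simp: p1_def)
    then have "finite p1" using finp finite_subset by blast
    note p1 = p1 this
    let ?s = "\<lambda>(x, K). f (Sup K) - f (Inf K)"
    have "f v - f u = sum ?s p" by (rule additive_tagged_division_1[OF uv p(1), symmetric])
    also have "\<dots> = sum ?s p1 + sum ?s (p - p1)" using finp p1 by (simp add: sum.subset_diff)
    also have "sum ?s (p - p1) \<le> (\<Sum>(x, K)\<in>p - p1. \<epsilon>1 * (Sup K - Inf K))"
    proof (rule sum_mono, clarify)
      fix x K assume xK: "(x, K) \<in> p" "(x, K) \<notin> p1"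
      then have xN: "x \<notin> N" by (simp add: p1_def)
      have m: "Inf K \<in> K" "Sup K \<in> K" "Inf K \<le> x" "x \<le> Sup K" "K \<subseteq> ball x (d x)" "x \<in> {u..v} - N"
        using mem[OF xK(1)] xN by (auto simp: G_def)
      have "\<bar>Sup K - x\<bar> < d x" "\<bar>Inf K - x\<bar> < d x"
        using m(1,2,5) by (auto simp: dist_real_def abs_minus_commute subset_iff)
      then have "f (Sup K) - f x \<le> \<epsilon>1 * (Sup K - x)" "f x - f (Inf K) \<le> \<epsilon>1 * (x - Inf K)"
        using d(2,3)[OF m(6)] m(3,4) by auto
      then show "f (Sup K) - f (Inf K) \<le> \<epsilon>1 * (Sup K - Inf K)" by (simp add: algebra_simps)
    qed
    also have "\<dots> \<le> (\<Sum>(x, K)\<in>p. \<epsilon>1 * (Sup K - Inf K))"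
      using mem e1(1) by (intro sum_mono2 finp) force+
    also have "\<dots> = \<epsilon>1 * (v - u)"
      using additive_tagged_division_1[OF uv p(1), of "\<lambda>t. \<epsilon>1 * t"] by (simp add: right_diff_distrib)
    also have "\<dots> \<le> \<epsilon> / 2" by (fact e1(2))
    also have "sum ?s p1 \<le> \<epsilon> / 2"
    proof -
      have pp: "p1 tagged_partial_division_of {u..v}"
        using p(1) p1(1) tagged_partial_division_subset by (auto simp: tagged_division_of_def)
      note td = tagged_partial_division_of_Union_self[OF pp]
      note dv = division_of_tagged_division[OF td]
      have sub: "\<Union>(snd ` p1) \<subseteq> {u..v}" "\<Union>(snd ` p1) \<subseteq> U"
        using mem p1(1) by (fastforce simp: p1_def G_def)+
      \<comment> \<open>Forgetting the tags can identify only degenerate intervals, which is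
        harmless for a summand that vanishes on them. The case distinction extends this to the empty
        interval, where \<open>Sup\<close> and \<open>Inf\<close> have no meaning as
        endpoints.\<close>
      have "sum ?s p1 \<le> (\<Sum>(x, K)\<in>p1. if K = {} then 0 else \<bar>f (Sup K) - f (Inf K)\<bar>)"
      proof (rule sum_mono, clarify)
        fix x K assume "(x, K) \<in> p1"
        then have "x \<in> K" using tagged_division_ofD(2)[OF td] by auto
        then show "f (Sup K) - f (Inf K) \<le> (if K = {} then 0 else \<bar>f (Sup K) - f (Inf K)\<bar>)" by auto
      qed
      also have "\<dots> = (\<Sum>K\<in>snd ` p1. if K = {} then 0 else \<bar>f (Sup K) - f (Inf K)\<bar>)"
      proof (rule sum.over_tagged_division_lemma[OF td])
        fix l r :: real assume "box l r = {}"
        then have "r \<le> l" by simp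
        then show "(if cbox l r = {} then 0 else \<bar>f (Sup (cbox l r)) - f (Inf (cbox l r))\<bar>) = 0"
          by (cases "l = r") auto
      qed
      also have "\<dots> \<le> (\<Sum>K\<in>snd ` p1. \<bar>f (Sup K) - f (Inf K)\<bar>)"
        by (rule sum_mono) auto
      also have "\<dots> < \<epsilon> / 2"
        using sum_length_division_le[OF dv sub(2) Um(1)] Um(2)
        by (intro eta(2) dv sub) auto
      finally show ?thesis by simp
    qed
    finally show ?thesis by simp
  qed
  from this[THEN diff_le_eq[THEN iffD1]] show ?thesis by (metis add.commute field_le_epsilon)
qed

text \<open>Let \<open>s\<close> be the last time with \<open>y s \<le> 0\<close>, which exists by
  continuity. After \<open>s\<close> the function is positive, so its derivative is nonpositive
  almost everywhere and \<open>y v \<le> y s\<close>.\<close>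

lemma abs_continuous_barrier:
  assumes ac: "abs_continuous_on_interval u v y" and uv: "u \<le> v" and yu: "y u \<le> 0"
    and ae: "AE t in lebesgue. t \<in> {u..v} \<longrightarrow> y t > 0 \<longrightarrow> (\<exists>D\<le>0. (y has_real_derivative D) (at t))"
  shows "y v \<le> 0"
proof -
  define S where "S = {t \<in> {u..v}. y t \<in> {..0}}"
  have "closed S" unfolding S_def
    using continuous_closed_preimage[OF abs_continuous_on_interval_imp_continuous_on[OF ac], of "{..0}"]
    by (simp add: vimage_def Int_def)
  moreover have S: "u \<in> S" "S \<subseteq> {u..v}" using yu uv by (auto simp: S_def)
  moreover have bdd: "bdd_above S" using S(2) by (meson bdd_above_Icc bdd_above_mono)
  ultimately have s: "Sup S \<in> S" by (intro closed_contains_Sup) auto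
  define s where "s = Sup S"
  have s: "u \<le> s" "s \<le> v" "y s \<le> 0" using s unfolding s_def[symmetric] by (auto simp: S_def)
  have pos: "y t > 0" if "t \<in> {s<..v}" for t
  proof (rule ccontr)
    assume "\<not> y t > 0"
    then have "t \<in> S" using that s by (auto simp: S_def)
    then have "t \<le> s" unfolding s_def by (intro cSup_upper bdd)
    then show False using that by simp
  qed
  have "y v \<le> y s"
  proof (rule abs_continuous_AE_deriv_nonpos_imp_le[where f = y])
    show "abs_continuous_on_interval s v y"
      by (rule abs_continuous_on_interval_subinterval[OF ac]) (use s in auto)
    show "AE t in lebesgue. t \<in> {s<..v} \<longrightarrow> (\<exists>D\<le>0. (y has_real_derivative D) (at t))"
      using ae by eventually_elim (use pos s in auto)
  qed (fact s(2))
  then show ?thesis using s(3) by simp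
qed

text \<open>A mean value inequality: subtracting \<open>L * t\<close> from \<open>f\<close> and from
  \<open>- f\<close> leaves functions with nonpositive derivative almost everywhere, to which the
  monotonicity lemma applies.\<close>

lemma abs_continuous_AE_deriv_le_imp_diff_le:
  assumes ac: "abs_continuous_on_interval u v f" and uv: "u \<le> v"
    and ae: "AE t in lebesgue. t \<in> {u..v} \<longrightarrow> f differentiable (at t) \<and> \<bar>deriv f t\<bar> \<le> L"
  shows "\<bar>f v - f u\<bar> \<le> L * (v - u)"
proof -
  have upper: "k v - k u \<le> L * (v - u)"
    if k: "abs_continuous_on_interval u v k"
      and kae: "AE t in lebesgue. t \<in> {u..v} \<longrightarrow> (\<exists>D\<le>L. (k has_real_derivative D) (at t))" for k
  proof -
    have "abs_continuous_on_interval u v (\<lambda>t. k t - L * t)"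
      by (intro abs_continuous_on_interval_diff k lipschitz_abs_continuous_on_interval[where L = "\<bar>L\<bar>"])
        (simp add: right_diff_distrib[symmetric] abs_mult)
    moreover have "AE t in lebesgue. t \<in> {u<..v} \<longrightarrow>
        (\<exists>D\<le>0. ((\<lambda>t. k t - L * t) has_real_derivative D) (at t))"
      using kae
    proof eventually_elim
      case (elim t)
      show ?case
      proof
        assume "t \<in> {u<..v}"
        then obtain D where "D \<le> L" "(k has_real_derivative D) (at t)" using elim by auto
        then show "\<exists>D\<le>0. ((\<lambda>t. k t - L * t) has_real_derivative D) (at t)"
          by (intro exI[of _ "D - L"]) (auto intro!: derivative_eq_intros)
      qed
    qed
    ultimately have "k v - L * v \<le> k u - L * u"
      by (rule abs_continuous_AE_deriv_nonpos_imp_le[OF _ uv])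
    then show ?thesis by (simp add: algebra_simps)
  qed
  have "f v - f u \<le> L * (v - u)"
  proof (rule upper[OF ac])
    show "AE t in lebesgue. t \<in> {u..v} \<longrightarrow> (\<exists>D\<le>L. (f has_real_derivative D) (at t))"
      using ae
      by eventually_elim (metis DERIV_deriv_iff_real_differentiable abs_le_D1)
  qed
  moreover have "- f v - - f u \<le> L * (v - u)"
  proof (rule upper[OF abs_continuous_on_interval_uminus[OF ac]])
    show "AE t in lebesgue. t \<in> {u..v} \<longrightarrow> (\<exists>D\<le>L. ((\<lambda>t. - f t) has_real_derivative D) (at t))"
      using ae
    proof eventually_elim
      case (elim t)
      show ?case
      proof
        assume "t \<in> {u..v}"
        with elim have "(f has_real_derivative deriv f t) (at t)" "- deriv f t \<le> L"
          by (auto simp: DERIV_deriv_iff_real_differentiable)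
        then show "\<exists>D\<le>L. ((\<lambda>t. - f t) has_real_derivative D) (at t)"
          by (intro exI[of _ "- deriv f t"]) (auto intro!: derivative_eq_intros)
      qed
    qed
  qed
  ultimately show ?thesis by linarith
qed

text \<open>The bounds obtained by iterating \<open>\<lambda>q. c + \<theta> * q\<close> from
  \<open>q0\<close> converge to the fixed point \<open>c / (1 - \<theta>)\<close>. Only countably
  many null sets arise, so the limiting bound holds almost everywhere. The starting value leaves no
  trace in it; this is how constants independent of the time horizon are obtained.\<close>

lemma AE_le_affine_contraction:
  fixes f w :: "'a \<Rightarrow> real" and c q0 \<theta> :: real
  assumes \<theta>: "0 \<le> \<theta>" "\<theta> < 1" and c: "0 \<le> c" and q0: "0 \<le> q0"
    and start: "AE t in M. R t \<longrightarrow> f t \<le> q0 * w t"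
    and step: "\<And>q. 0 \<le> q \<Longrightarrow> AE t in M. R t \<longrightarrow> f t \<le> q * w t
                 \<Longrightarrow> AE t in M. R t \<longrightarrow> f t \<le> (c + \<theta> * q) * w t"
  shows "AE t in M. R t \<longrightarrow> f t \<le> c / (1 - \<theta>) * w t"
proof -
  define q where "q n = ((\<lambda>q. c + \<theta> * q) ^^ n) q0" for n
  have q: "0 \<le> q n \<and> (AE t in M. R t \<longrightarrow> f t \<le> q n * w t)" for n
    by (induction n) (use assms in \<open>auto simp: q_def\<close>)
  have q_eq: "q n = c / (1 - \<theta>) + \<theta> ^ n * (q0 - c / (1 - \<theta>))" for n
  proof (induction n)
    case (Suc n)
    have "q (Suc n) = c + \<theta> * q n" by (simp add: q_def)
    also have "\<dots> = (c + \<theta> * (c / (1 - \<theta>))) + \<theta> ^ Suc n * (q0 - c / (1 - \<theta>))"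
      unfolding Suc by (simp add: distrib_left)
    also have "c + \<theta> * (c / (1 - \<theta>)) = c / (1 - \<theta>)" using \<theta> by (simp add: field_simps)
    finally show ?case .
  qed (simp add: q_def)
  have lim: "(\<lambda>n. q n * y) \<longlonglongrightarrow> c / (1 - \<theta>) * y" for y
    using \<theta> unfolding q_eq by (auto intro!: tendsto_eq_intros LIMSEQ_power_zero)
  have "AE t in M. \<forall>n. R t \<longrightarrow> f t \<le> q n * w t"
    unfolding AE_all_countable using q by blast
  then show ?thesis
    by eventually_elim (meson LIMSEQ_le_const[OF lim])
qed

text \<open>The preimage of the exceptional null set is null. This carries bounds on the derivative
  over to the delayed argument \<open>g t\<close>.\<close>

lemma AE_lebesgue_vimage:
  assumes "\<And>E. E \<in> null_sets lebesgue \<Longrightarrow> {t \<in> S. g t \<in> E} \<in> null_sets lebesgue"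
    and "AE t in lebesgue. P t"
  shows "AE t in lebesgue. t \<in> S \<longrightarrow> P (g t)"
proof -
  obtain N where N: "\<And>t. t \<in> space lebesgue - N \<Longrightarrow> P t" "N \<in> null_sets lebesgue"
    by (rule AE_E3[OF assms(2)], rule that, assumption+)
  show ?thesis
    by (rule AE_I'[OF assms(1)[OF N(2)]]) (use N(1) in auto)
qed

text \<open>The function \<open>K * exp (- \<gamma> * (t - \<sigma>))\<close> is a supersolution of
  the equation with right-hand side \<open>B t * r * exp (- \<gamma> * (t - \<sigma>))\<close>, by
  \<open>\<beta> \<le> B t\<close> and the choice of \<open>K\<close>. Wherever \<open>x\<close> or
  \<open>- x\<close> exceeds it, the difference has nonpositive derivative, so the barrier lemma
  applies.\<close>

lemma exp_barrier:
  assumes ac: "abs_continuous_on_interval \<sigma> v x" and v: "\<sigma> \<le> v"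
    and dif: "AE t in lebesgue. t \<in> {\<sigma>..v} \<longrightarrow> x differentiable (at t)"
    and ae: "AE t in lebesgue. t \<in> {\<sigma>..v} \<longrightarrow>
              \<bar>deriv x t + B t * x t\<bar> \<le> B t * r * exp (- \<gamma> * (t - \<sigma>))"
    and B: "\<And>t. t \<in> {\<sigma>..v} \<Longrightarrow> \<beta> \<le> B t"
    and \<gamma>: "0 \<le> \<gamma>" and \<beta>: "0 < \<beta>" and r: "0 \<le> r"
    and K: "r \<le> (1 - \<gamma> / \<beta>) * K" "\<bar>x \<sigma>\<bar> \<le> K"
  shows "\<bar>x v\<bar> \<le> K * exp (- \<gamma> * (v - \<sigma>))"
proof -
  define w where "w t = K * exp (- \<gamma> * (t - \<sigma>))" for t
  have K0: "0 \<le> K" using K(2) by linarith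
  have w0: "0 \<le> w t" for t using K0 by (simp add: w_def)
  have dw: "(w has_real_derivative - \<gamma> * w t) (at t)" for t
    unfolding w_def by (auto intro!: derivative_eq_intros)
  have acw: "abs_continuous_on_interval \<sigma> v w"
  proof (rule lipschitz_abs_continuous_on_interval[where L = "\<gamma> * K"])
    fix s t assume st: "\<sigma> \<le> s" "s \<le> t"
    show "\<bar>w t - w s\<bar> \<le> \<gamma> * K * (t - s)"
    proof (cases "s = t")
      case False
      then obtain z where z: "s < z" "z < t" "w t - w s = (t - s) * (- \<gamma> * w z)"
        using MVT2[of s t w "\<lambda>t. - \<gamma> * w t"] dw st by auto
      have "w z \<le> K * 1" unfolding w_def
        using z st \<gamma> K0 by (intro mult_left_mono) auto
      then have "\<bar>w t - w s\<bar> \<le> (t - s) * (\<gamma> * K)"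
        using z(3) st \<gamma> w0[of z] by (auto simp: abs_mult intro!: mult_left_mono)
      then show ?thesis by (simp add: mult_ac)
    qed simp
  qed
  \<comment> \<open>The one-sided comparison is stated for a general \<open>y\<close> because it is
    applied to both \<open>x\<close> and \<open>- x\<close>.\<close>
  have main: "y v \<le> w v"
    if acy: "abs_continuous_on_interval \<sigma> v y" and y0: "y \<sigma> \<le> K"
      and aey: "AE t in lebesgue. t \<in> {\<sigma>..v} \<longrightarrow> (\<exists>D. (y has_real_derivative D) (at t) \<and>
              D + B t * y t \<le> B t * r * exp (- \<gamma> * (t - \<sigma>)))" for y
  proof -
    have "y v - w v \<le> 0"
    proof (rule abs_continuous_barrier[where y = "\<lambda>t. y t - w t", OF _ v])
      show "abs_continuous_on_interval \<sigma> v (\<lambda>t. y t - w t)"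
        by (intro abs_continuous_on_interval_diff acy acw)
      show "y \<sigma> - w \<sigma> \<le> 0" using y0 by (simp add: w_def)
      show "AE t in lebesgue. t \<in> {\<sigma>..v} \<longrightarrow> 0 < y t - w t \<longrightarrow>
              (\<exists>D\<le>0. ((\<lambda>t. y t - w t) has_real_derivative D) (at t))"
        using aey
      proof eventually_elim
        case (elim t)
        show ?case
        proof (intro impI)
          assume t: "t \<in> {\<sigma>..v}" and pos: "0 < y t - w t"
          then obtain D where D: "(y has_real_derivative D) (at t)"
            "D + B t * y t \<le> B t * r * exp (- \<gamma> * (t - \<sigma>))" using elim by auto
          have Bt: "\<beta> \<le> B t" "0 < B t" using B[OF t] \<beta> by auto
          \<comment> \<open>The lower bound \<open>\<beta>\<close> turns the rate
            \<open>\<gamma>\<close> into a multiple of \<open>B t\<close>; what remains is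
            \<open>\<gamma> / \<beta> * K \<le> K - r\<close>, the condition on
            \<open>K\<close>.\<close>
          have "\<gamma> * K \<le> B t * (\<gamma> / \<beta> * K)"
            using mult_right_mono[OF Bt(1), of "\<gamma> * K"] \<beta> \<gamma> K0 by (simp add: field_simps)
          also have "\<dots> \<le> B t * (K - r)"
            using K(1) Bt by (intro mult_left_mono) (auto simp: algebra_simps)
          finally have "\<gamma> * K * exp (- \<gamma> * (t - \<sigma>)) \<le> B t * (K - r) * exp (- \<gamma> * (t - \<sigma>))"
            by (intro mult_right_mono) auto
          then have "\<gamma> * w t \<le> B t * w t - B t * r * exp (- \<gamma> * (t - \<sigma>))"
            by (simp add: w_def algebra_simps)
          moreover have "B t * w t \<le> B t * y t" using pos Bt by (intro mult_left_mono) auto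
          ultimately have "D - (- \<gamma> * w t) \<le> 0" using D(2) by simp
          then show "\<exists>D\<le>0. ((\<lambda>t. y t - w t) has_real_derivative D) (at t)"
            using DERIV_diff[OF D(1) dw[of t]] by blast
        qed
      qed
    qed
    then show ?thesis by simp
  qed
  have "x v \<le> w v"
  proof (rule main[OF ac])
    show "x \<sigma> \<le> K" using K(2) by simp
    show "AE t in lebesgue. t \<in> {\<sigma>..v} \<longrightarrow> (\<exists>D. (x has_real_derivative D) (at t) \<and>
              D + B t * x t \<le> B t * r * exp (- \<gamma> * (t - \<sigma>)))"
      using dif ae
      by eventually_elim (metis DERIV_deriv_iff_real_differentiable abs_le_D1)
  qed
  moreover have "- x v \<le> w v"
  proof (rule main[OF abs_continuous_on_interval_uminus[OF ac]])
    show "- x \<sigma> \<le> K" using K(2) by simp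
    show "AE t in lebesgue. t \<in> {\<sigma>..v} \<longrightarrow> (\<exists>D. ((\<lambda>t. - x t) has_real_derivative D) (at t) \<and>
              D + B t * - x t \<le> B t * r * exp (- \<gamma> * (t - \<sigma>)))"
      using dif ae
    proof eventually_elim
      case (elim t)
      show ?case
      proof
        assume t: "t \<in> {\<sigma>..v}"
        then have "((\<lambda>t. - x t) has_real_derivative - deriv x t) (at t)"
          using elim by (auto simp: DERIV_deriv_iff_real_differentiable intro: DERIV_minus)
        moreover have "- deriv x t + B t * - x t \<le> B t * r * exp (- \<gamma> * (t - \<sigma>))"
          using elim t by (auto simp: abs_le_iff)
        ultimately show "\<exists>D. ((\<lambda>t. - x t) has_real_derivative D) (at t) \<and>
              D + B t * - x t \<le> B t * r * exp (- \<gamma> * (t - \<sigma>))" by blast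
      qed
    qed
  qed
  ultimately show ?thesis by (simp add: w_def abs_le_iff)
qed

section \<open>A priori bounds for solutions\<close>

text \<open>Real constants replace the essential norms over the half-line from \<open>t0\<close>:
  \<open>A\<close> for that of \<open>a\<close>, \<open>Ka\<close> for \<open>a / B\<close>,
  \<open>bb k\<close> for \<open>b k\<close> and \<open>\<kappa> k\<close> for
  \<open>b k / B\<close>, the quotients with denominators cleared. \<open>d\<close> bounds all
  delays at once.\<close>

locale neutral_delay =
  fixes t0 A Ka \<beta> d :: real
    and a g B :: "real \<Rightarrow> real"
    and b h :: "nat \<Rightarrow> real \<Rightarrow> real"
    and \<tau> \<kappa> bb :: "nat \<Rightarrow> real"
    and I J :: "nat set"
  assumes t0: "0 \<le> t0"
    and finI: "finite I" and JI: "J \<subseteq> I"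
    and A0: "0 \<le> A" and a_le: "AE t in lebesgue. t0 \<le> t \<longrightarrow> \<bar>a t\<bar> \<le> A"
    and Ka0: "0 \<le> Ka" and a_le_B: "AE t in lebesgue. t0 \<le> t \<longrightarrow> \<bar>a t\<bar> \<le> Ka * B t"
    and bb0: "\<And>k. k \<in> I \<Longrightarrow> 0 \<le> bb k"
    and b_le: "\<And>k. k \<in> I \<Longrightarrow> AE t in lebesgue. t0 \<le> t \<longrightarrow> \<bar>b k t\<bar> \<le> bb k"
    and \<kappa>0: "\<And>k. k \<in> I \<Longrightarrow> 0 \<le> \<kappa> k"
    and b_le_B: "\<And>k. k \<in> I \<Longrightarrow> AE t in lebesgue. t0 \<le> t \<longrightarrow> \<bar>b k t\<bar> \<le> \<kappa> k * B t"
    and B_eq: "\<And>t. B t = (\<Sum>k\<in>J. b k t)"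
    and \<beta>: "0 < \<beta>" and B_ge: "\<And>t. t0 \<le> t \<Longrightarrow> \<beta> \<le> B t"
    and g: "\<And>t. 0 \<le> t \<Longrightarrow> g t \<le> t \<and> t - g t \<le> d"
    and h: "\<And>k t. k \<in> I \<Longrightarrow> 0 \<le> t \<Longrightarrow> h k t \<le> t \<and> t - h k t \<le> \<tau> k"
    and \<tau>: "\<And>k. k \<in> I \<Longrightarrow> 0 \<le> \<tau> k \<and> \<tau> k \<le> d"
    and g_null: "\<And>E. E \<in> null_sets lebesgue \<Longrightarrow> {t \<in> {0..}. g t \<in> E} \<in> null_sets lebesgue"

text \<open>\<open>N\<close> bounds both initial functions. \<open>e\<close> is the weight, and
  \<open>E\<close> bounds the factor it can gain across a delay. \<open>X\<close> and
  \<open>Z\<close> are the solution and its derivative with the initial data spliced in; they treat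
  the point \<open>\<sigma>\<close> differently, as the notion of solution does.\<close>

locale neutral_delay_solution = neutral_delay +
  fixes \<sigma> N \<gamma> E :: real and \<phi> \<psi> x e X Z :: "real \<Rightarrow> real"
  assumes \<sigma>: "t0 \<le> \<sigma>" and N0: "0 \<le> N"
    and \<phi>_le: "\<And>s. s \<le> \<sigma> \<Longrightarrow> \<bar>\<phi> s\<bar> \<le> N" and \<psi>_le: "\<And>s. s < \<sigma> \<Longrightarrow> \<bar>\<psi> s\<bar> \<le> N"
    and \<gamma>: "0 \<le> \<gamma>" "\<gamma> < \<beta>"
    and x_\<sigma>: "x \<sigma> = \<phi> \<sigma>"
    and x_ac: "\<And>c. \<sigma> \<le> c \<Longrightarrow> abs_continuous_on_interval \<sigma> c x"
    and x_diff: "AE t in lebesgue. \<sigma> \<le> t \<longrightarrow> x differentiable (at t)"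
    and x_bnd: "\<And>c. \<sigma> \<le> c \<Longrightarrow> \<exists>q\<ge>0. AE t in lebesgue. t \<in> {\<sigma>..c} \<longrightarrow> \<bar>deriv x t\<bar> \<le> q"
    and e_def: "e \<equiv> \<lambda>t. exp (- \<gamma> * (t - \<sigma>))"
    and E_def: "E \<equiv> exp (\<gamma> * d)"
    and X_def: "X \<equiv> \<lambda>t. if t \<le> \<sigma> then \<phi> t else x t"
    and Z_def: "Z \<equiv> \<lambda>t. if t < \<sigma> then \<psi> t else deriv x t"
    and x_eq: "AE t in lebesgue. \<sigma> \<le> t \<longrightarrow> deriv x t - a t * Z (g t) = - (\<Sum>k\<in>I. b k t * X (h k t))"
begin

section \<open>The weight and the values at delayed arguments\<close>

lemma e_pos: "0 < e t"
  by (simp add: e_def)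

lemma e_antimono: "s \<le> t \<Longrightarrow> e t \<le> e s"
  using \<gamma> by (simp add: e_def mult_left_mono)

lemma one_le_e: "s \<le> \<sigma> \<Longrightarrow> 1 \<le> e s"
  using \<gamma> by (simp add: e_def mult_nonneg_nonpos)

lemma E_pos: "0 < E"
  by (simp add: E_def)

lemma e_shift: "t - s \<le> d \<Longrightarrow> e s \<le> E * e t"
  using \<gamma> mult_left_mono[of "t - s" d \<gamma>]
  by (simp add: e_def E_def exp_add[symmetric] algebra_simps)

lemma h_le:
  assumes "k \<in> I" "\<sigma> \<le> t"
  shows "h k t \<le> t" "t - h k t \<le> \<tau> k" "t - h k t \<le> d"
  using h[of k t] \<tau>[of k] assms t0 \<sigma> by auto

text \<open>Up to \<open>\<sigma>\<close> the weight is at least 1, so \<open>N\<close> is also a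
  weighted bound there; after \<open>\<sigma>\<close> the constant \<open>P\<close> serves.
  Returning from \<open>h k t\<close> to \<open>t\<close> costs the factor \<open>E\<close>.\<close>

lemma X_delay_le:
  assumes P: "0 \<le> P" "\<And>t. t \<in> {\<sigma>..T} \<Longrightarrow> \<bar>x t\<bar> \<le> P * e t" and k: "k \<in> I" and t: "t \<in> {\<sigma>..T}"
  shows "\<bar>X (h k t)\<bar> \<le> (P + N) * (E * e t)"
proof -
  let ?s = "h k t"
  have s: "?s \<le> t" "t - ?s \<le> d" using h_le[OF k] t by auto
  have "\<bar>X ?s\<bar> \<le> (P + N) * e ?s"
  proof (cases "?s \<le> \<sigma>")
    case True
    then have "\<bar>X ?s\<bar> \<le> N * 1" using \<phi>_le by (simp add: X_def)
    also have "\<dots> \<le> (P + N) * e ?s"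
      using P(1) N0 one_le_e[OF True] by (intro mult_mono) auto
    finally show ?thesis .
  next
    case False
    then have "\<bar>X ?s\<bar> \<le> P * e ?s" using P(2)[of ?s] s t by (simp add: X_def)
    also have "\<dots> \<le> (P + N) * e ?s" using N0 e_pos[of ?s] by (intro mult_right_mono) auto
    finally show ?thesis .
  qed
  also have "\<dots> \<le> (P + N) * (E * e t)" using P(1) N0 e_shift[OF s(2)] by (intro mult_left_mono) auto
  finally show ?thesis .
qed

text \<open>Same splitting at \<open>\<sigma>\<close> as for \<open>X\<close>. The bound on the
  derivative holds only off a null set, whose preimage under \<open>g\<close> is again null.\<close>

lemma Z_delay_le:
  assumes q: "0 \<le> q" "AE t in lebesgue. t \<in> {\<sigma>..T} \<longrightarrow> \<bar>deriv x t\<bar> \<le> q * e t"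
  shows "AE t in lebesgue. t \<in> {\<sigma>..T} \<longrightarrow> \<bar>Z (g t)\<bar> \<le> (q + N) * (E * e t)"
proof -
  have "AE t in lebesgue. t \<in> {0..} \<longrightarrow> g t \<in> {\<sigma>..T} \<longrightarrow> \<bar>deriv x (g t)\<bar> \<le> q * e (g t)"
    by (rule AE_lebesgue_vimage[OF g_null q(2)])
  then show ?thesis
  proof eventually_elim
    case (elim t)
    show ?case
    proof
      assume t: "t \<in> {\<sigma>..T}"
      let ?s = "g t"
      have s: "?s \<le> t" "t - ?s \<le> d" "0 \<le> t" using g[of t] t \<sigma> t0 by auto
      have "\<bar>Z ?s\<bar> \<le> (q + N) * e ?s"
      proof (cases "?s < \<sigma>")
        case True
        then have "\<bar>Z ?s\<bar> \<le> N * 1" using \<psi>_le by (simp add: Z_def)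
        also have "\<dots> \<le> (q + N) * e ?s"
          using q(1) N0 one_le_e[of ?s] True by (intro mult_mono) auto
        finally show ?thesis .
      next
        case False
        then have "\<bar>Z ?s\<bar> \<le> q * e ?s" using elim s t by (simp add: Z_def)
        also have "\<dots> \<le> (q + N) * e ?s" using N0 e_pos[of ?s] by (intro mult_right_mono) auto
        finally show ?thesis .
      qed
      also have "\<dots> \<le> (q + N) * (E * e t)"
        using q(1) N0 e_shift[OF s(2)] by (intro mult_left_mono) auto
      finally show "\<bar>Z (g t)\<bar> \<le> (q + N) * (E * e t)" .
    qed
  qed
qed

section \<open>Estimates derived from the equation\<close>

lemma AE_ball_index:
  assumes "\<And>k. k \<in> I \<Longrightarrow> AE t in lebesgue. P k t"
  shows "AE t in lebesgue. \<forall>k\<in>I. P k t"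
  using assms finI by (simp add: AE_finite_all)

text \<open>Inserting a weighted bound \<open>q\<close> for the derivative into the equation returns
  \<open>A * E * q\<close> plus terms in \<open>P\<close> and \<open>N\<close>. As
  \<open>A * E < 1\<close>, iteration leads to the fixed point.\<close>

lemma deriv_le:
  assumes T: "\<sigma> \<le> T" and P: "0 \<le> P" "\<And>t. t \<in> {\<sigma>..T} \<Longrightarrow> \<bar>x t\<bar> \<le> P * e t" and AE1: "A * E < 1"
  shows "AE t in lebesgue. t \<in> {\<sigma>..T} \<longrightarrow>
    \<bar>deriv x t\<bar> \<le> (A * E * N + (\<Sum>k\<in>I. bb k) * E * (P + N)) / (1 - A * E) * e t"
proof -
  obtain q1 where q1: "0 \<le> q1" "AE t in lebesgue. t \<in> {\<sigma>..T} \<longrightarrow> \<bar>deriv x t\<bar> \<le> q1"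
    using x_bnd[OF T] by auto
  have bI: "AE t in lebesgue. \<forall>k\<in>I. t0 \<le> t \<longrightarrow> \<bar>b k t\<bar> \<le> bb k"
    by (rule AE_ball_index[OF b_le])
  have S0: "0 \<le> (\<Sum>k\<in>I. bb k)" using bb0 by (rule sum_nonneg)
  show ?thesis
  \<comment> \<open>The weight is least at \<open>T\<close>, so dividing by \<open>e T\<close> makes
    the local bound \<open>q1\<close> a weighted one.\<close>
  proof (rule AE_le_affine_contraction[where ?q0.0 = "q1 / e T"])
    show "0 \<le> A * E" using A0 E_pos by simp
    show "0 \<le> A * E * N + (\<Sum>k\<in>I. bb k) * E * (P + N)" using A0 E_pos N0 P(1) S0 by simp
    show "0 \<le> q1 / e T" using q1(1) e_pos[of T] by simp
    show "AE t in lebesgue. t \<in> {\<sigma>..T} \<longrightarrow> \<bar>deriv x t\<bar> \<le> q1 / e T * e t"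
      using q1(2)
    proof eventually_elim
      case (elim t)
      show ?case
      proof
        assume t: "t \<in> {\<sigma>..T}"
        then have "\<bar>deriv x t\<bar> \<le> q1" using elim by simp
        also have "\<dots> \<le> q1 / e T * e t"
          using e_antimono[of t T] t e_pos[of T] q1(1)
          by (simp add: pos_le_divide_eq mult_left_mono)
        finally show "\<bar>deriv x t\<bar> \<le> q1 / e T * e t" .
      qed
    qed
  next
    fix q :: real assume q: "0 \<le> q" "AE t in lebesgue. t \<in> {\<sigma>..T} \<longrightarrow> \<bar>deriv x t\<bar> \<le> q * e t"
    show "AE t in lebesgue. t \<in> {\<sigma>..T} \<longrightarrow>
       \<bar>deriv x t\<bar> \<le> (A * E * N + (\<Sum>k\<in>I. bb k) * E * (P + N) + A * E * q) * e t"
      using x_eq Z_delay_le[OF q] a_le bI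
    proof eventually_elim
      case (elim t)
      show ?case
      proof
        assume t: "t \<in> {\<sigma>..T}"
        then have tt: "t0 \<le> t" "\<sigma> \<le> t" using \<sigma> by auto
        have "\<bar>a t * Z (g t)\<bar> \<le> A * ((q + N) * (E * e t))"
          unfolding abs_mult using elim t tt A0 by (intro mult_mono) auto
        moreover have "\<bar>\<Sum>k\<in>I. b k t * X (h k t)\<bar> \<le> (\<Sum>k\<in>I. bb k) * ((P + N) * (E * e t))"
          unfolding sum_distrib_right
        proof (rule order_trans[OF sum_abs sum_mono])
          fix k assume k: "k \<in> I"
          show "\<bar>b k t * X (h k t)\<bar> \<le> bb k * ((P + N) * (E * e t))"
            unfolding abs_mult using elim k tt bb0 X_delay_le[OF P k t] by (intro mult_mono) auto
        qed
        ultimately have "\<bar>deriv x t\<bar> \<le>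
            A * ((q + N) * (E * e t)) + (\<Sum>k\<in>I. bb k) * ((P + N) * (E * e t))"
          using elim tt by linarith
        then show "\<bar>deriv x t\<bar> \<le> (A * E * N + (\<Sum>k\<in>I. bb k) * E * (P + N) + A * E * q) * e t"
          by (simp add: algebra_simps)
      qed
    qed
  qed (fact AE1)
qed

lemma increment_le:
  assumes st: "\<sigma> \<le> s" "s \<le> t" "t \<le> T" "t - s \<le> d"
    and q: "0 \<le> q" "AE t in lebesgue. t \<in> {\<sigma>..T} \<longrightarrow> \<bar>deriv x t\<bar> \<le> q * e t"
  shows "\<bar>x t - x s\<bar> \<le> q * (E * e t) * (t - s)"
proof (rule abs_continuous_AE_deriv_le_imp_diff_le)
  show "abs_continuous_on_interval s t x"
    by (rule abs_continuous_on_interval_subinterval[OF x_ac[of t]]) (use st in auto)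
  show "AE r in lebesgue. r \<in> {s..t} \<longrightarrow> x differentiable (at r) \<and> \<bar>deriv x r\<bar> \<le> q * (E * e t)"
    using x_diff q(2)
  proof eventually_elim
    case (elim r)
    show ?case
    proof
      assume r: "r \<in> {s..t}"
      have "q * e r \<le> q * (E * e t)" using r st q(1) by (intro mult_left_mono e_shift) auto
      then show "x differentiable (at r) \<and> \<bar>deriv x r\<bar> \<le> q * (E * e t)" using elim r st by auto
    qed
  qed
qed (fact st)

text \<open>The increment is split at \<open>max \<sigma> (h k t)\<close>. After
  \<open>\<sigma>\<close> the derivative bound acts over a length of at most
  \<open>\<tau> k\<close>; before it, two values of \<open>\<phi>\<close> differ by at most
  \<open>2 * N\<close>, without any continuity of \<open>\<phi>\<close>.\<close>

lemma delay_increment_le: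
  assumes q: "0 \<le> q" "AE t in lebesgue. t \<in> {\<sigma>..T} \<longrightarrow> \<bar>deriv x t\<bar> \<le> q * e t"
    and k: "k \<in> I" and t: "t \<in> {\<sigma>..T}"
  shows "\<bar>x t - X (h k t)\<bar> \<le> (\<tau> k * q + 2 * N) * (E * e t)"
proof -
  let ?s = "max \<sigma> (h k t)"
  note hk = h_le[OF k, of t]
  have s: "\<sigma> \<le> ?s" "?s \<le> t" "t \<le> T" "t - ?s \<le> d" "t - ?s \<le> \<tau> k"
    using hk t by auto
  have Ee: "0 < E * e t" using E_pos e_pos[of t] by simp
  have "\<bar>x t - x ?s\<bar> \<le> q * (E * e t) * (t - ?s)"
    by (rule increment_le[OF s(1-4) q])
  also have "\<dots> \<le> q * (E * e t) * \<tau> k"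
    using s(5) q(1) Ee by (intro mult_left_mono) auto
  finally have 1: "\<bar>x t - x ?s\<bar> \<le> q * (E * e t) * \<tau> k" .
  have 2: "\<bar>x ?s - X (h k t)\<bar> \<le> 2 * N * (E * e t)"
  proof (cases "h k t \<le> \<sigma>")
    case True
    then have "t - \<sigma> \<le> d" using hk t by auto
    \<comment> \<open>The weight equals 1 at \<open>\<sigma>\<close> and has lost at most the factor
      \<open>E\<close> by time \<open>t\<close>, so the constant \<open>2 * N\<close> is also a
      weighted bound.\<close>
    then have "1 \<le> E * e t" using e_shift[of t \<sigma>] one_le_e[of \<sigma>] by simp
    then have "2 * N * 1 \<le> 2 * N * (E * e t)" using N0 by (intro mult_left_mono) auto
    moreover have "\<bar>x ?s - X (h k t)\<bar> \<le> 2 * N"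
      using True x_\<sigma> \<phi>_le[of \<sigma>] \<phi>_le[OF True] by (simp add: X_def max_def)
    ultimately show ?thesis by simp
  next
    case False
    then show ?thesis using N0 Ee by (simp add: X_def max_def)
  qed
  have "\<bar>x t - X (h k t)\<bar> \<le> q * (E * e t) * \<tau> k + 2 * N * (E * e t)" using 1 2 by linarith
  then show ?thesis by (simp add: algebra_simps)
qed

text \<open>Adding \<open>B t * x t\<close> turns the terms with index in \<open>J\<close> into
  differences between \<open>x t\<close> and its delayed values, which the derivative bound
  controls. Measuring every coefficient against \<open>B t\<close> gives the form required by
  \<open>exp_barrier\<close>.\<close>

lemma remainder_le:
  assumes P: "0 \<le> P" "\<And>t. t \<in> {\<sigma>..T} \<Longrightarrow> \<bar>x t\<bar> \<le> P * e t"
    and q: "0 \<le> q" "AE t in lebesgue. t \<in> {\<sigma>..T} \<longrightarrow> \<bar>deriv x t\<bar> \<le> q * e t"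
  shows "AE t in lebesgue. t \<in> {\<sigma>..T} \<longrightarrow> \<bar>deriv x t + B t * x t\<bar> \<le>
    B t * (E * (Ka * (q + N) + (\<Sum>k\<in>J. \<kappa> k * (\<tau> k * q + 2 * N)) + (\<Sum>k\<in>I - J. \<kappa> k) * (P + N))) * e t"
proof -
  have bI: "AE t in lebesgue. \<forall>k\<in>I. t0 \<le> t \<longrightarrow> \<bar>b k t\<bar> \<le> \<kappa> k * B t"
    by (rule AE_ball_index[OF b_le_B])
  show ?thesis
    using x_eq Z_delay_le[OF q] a_le_B bI
  proof eventually_elim
    case (elim t)
    show ?case
    proof
      assume t: "t \<in> {\<sigma>..T}"
      then have tt: "t0 \<le> t" "\<sigma> \<le> t" using \<sigma> by auto
      have Bt: "0 \<le> B t" using B_ge[OF tt(1)] \<beta> by simp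
      have "(\<Sum>k\<in>I. b k t * X (h k t)) = (\<Sum>k\<in>I - J. b k t * X (h k t)) + (\<Sum>k\<in>J. b k t * X (h k t))"
        by (rule sum.subset_diff[OF JI finI])
      moreover have "B t * x t - (\<Sum>k\<in>J. b k t * X (h k t)) = (\<Sum>k\<in>J. b k t * (x t - X (h k t)))"
        by (simp add: B_eq sum_distrib_right sum_subtractf right_diff_distrib)
      ultimately have eq: "deriv x t + B t * x t =
          a t * Z (g t) + (\<Sum>k\<in>J. b k t * (x t - X (h k t))) - (\<Sum>k\<in>I - J. b k t * X (h k t))"
        using elim(1) tt by linarith
      have "\<bar>a t * Z (g t)\<bar> \<le> Ka * B t * ((q + N) * (E * e t))"
        unfolding abs_mult using elim t tt Ka0 Bt by (intro mult_mono) auto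
      moreover have "\<bar>\<Sum>k\<in>J. b k t * (x t - X (h k t))\<bar> \<le>
          (\<Sum>k\<in>J. \<kappa> k * B t * ((\<tau> k * q + 2 * N) * (E * e t)))"
      proof (rule order_trans[OF sum_abs sum_mono])
        fix k assume "k \<in> J"
        then have k: "k \<in> I" using JI by auto
        show "\<bar>b k t * (x t - X (h k t))\<bar> \<le> \<kappa> k * B t * ((\<tau> k * q + 2 * N) * (E * e t))"
          unfolding abs_mult using elim k tt \<kappa>0 Bt delay_increment_le[OF q k t]
          by (intro mult_mono) auto
      qed
      moreover have "\<bar>\<Sum>k\<in>I - J. b k t * X (h k t)\<bar> \<le> (\<Sum>k\<in>I - J. \<kappa> k * B t * ((P + N) * (E * e t)))"
      proof (rule order_trans[OF sum_abs sum_mono])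
        fix k assume "k \<in> I - J"
        then have k: "k \<in> I" by auto
        show "\<bar>b k t * X (h k t)\<bar> \<le> \<kappa> k * B t * ((P + N) * (E * e t))"
          unfolding abs_mult using elim k tt \<kappa>0 Bt X_delay_le[OF P k t] by (intro mult_mono) auto
      qed
      moreover have "(\<Sum>k\<in>J. \<kappa> k * B t * ((\<tau> k * q + 2 * N) * (E * e t))) =
          B t * E * e t * (\<Sum>k\<in>J. \<kappa> k * (\<tau> k * q + 2 * N))"
        by (simp add: sum_distrib_left mult_ac)
      moreover have "(\<Sum>k\<in>I - J. \<kappa> k * B t * ((P + N) * (E * e t))) =
          B t * E * e t * ((\<Sum>k\<in>I - J. \<kappa> k) * (P + N))"
        by (simp add: sum_distrib_left sum_distrib_right mult_ac)
      ultimately have "\<bar>deriv x t + B t * x t\<bar> \<le> Ka * B t * ((q + N) * (E * e t)) +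
          B t * E * e t * (\<Sum>k\<in>J. \<kappa> k * (\<tau> k * q + 2 * N)) +
          B t * E * e t * ((\<Sum>k\<in>I - J. \<kappa> k) * (P + N))"
        unfolding eq by linarith
      also have "\<dots> = B t * (E * (Ka * (q + N) + (\<Sum>k\<in>J. \<kappa> k * (\<tau> k * q + 2 * N)) +
          (\<Sum>k\<in>I - J. \<kappa> k) * (P + N))) * e t"
        by (simp add: distrib_left distrib_right mult_ac)
      finally show "\<bar>deriv x t + B t * x t\<bar> \<le> B t * (E * (Ka * (q + N) +
          (\<Sum>k\<in>J. \<kappa> k * (\<tau> k * q + 2 * N)) + (\<Sum>k\<in>I - J. \<kappa> k) * (P + N))) * e t" .
    qed
  qed
qed

section \<open>Decay with constants independent of the time horizon\<close>

lemma solution_bounded: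
  assumes T: "\<sigma> \<le> T"
  obtains P where "0 \<le> P" "\<And>t. t \<in> {\<sigma>..T} \<Longrightarrow> \<bar>x t\<bar> \<le> P * e t"
proof -
  have "continuous_on {\<sigma>..T} x"
    by (rule abs_continuous_on_interval_imp_continuous_on[OF x_ac[OF T]])
  then have "compact (x ` {\<sigma>..T})" by (intro compact_continuous_image) auto
  then have "bounded (x ` {\<sigma>..T})" by (rule compact_imp_bounded)
  then obtain p where p: "\<And>t. t \<in> {\<sigma>..T} \<Longrightarrow> \<bar>x t\<bar> \<le> p"
    unfolding bounded_iff real_norm_def by blast
  then have p0: "0 \<le> p" using T by (meson abs_ge_zero atLeastAtMost_iff order_refl order_trans)
  show thesis
  proof
    show "0 \<le> p / e T" using p0 e_pos[of T] by simp
    fix t assume t: "t \<in> {\<sigma>..T}"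
    have "p \<le> p / e T * e t"
      using e_antimono[of t T] t e_pos[of T] p0 by (simp add: pos_le_divide_eq mult_left_mono)
    then show "\<bar>x t\<bar> \<le> p / e T * e t" using p[OF t] by linarith
  qed
qed

text \<open>A bound \<open>P\<close> for \<open>x\<close> gives \<open>q\<close> for the derivative,
  then \<open>r = \<alpha> * P + \<rho> * N\<close> for the remainder, and by comparison the new
  bound \<open>N + \<mu> * r\<close>. Since \<open>\<mu> * \<alpha> < 1\<close> this map contracts.
  For \<open>\<gamma> = 0\<close> both \<open>E\<close> and \<open>\<mu>\<close> are 1, and
  \<open>\<alpha>\<close> has the shape of the left-hand side of the stability condition.\<close>

lemma solution_decay:
  fixes S L KJ K2 \<alpha> \<rho> \<mu> :: real
  defines "S \<equiv> \<Sum>k\<in>I. bb k" and "L \<equiv> \<Sum>k\<in>J. \<tau> k * \<kappa> k" and "KJ \<equiv> \<Sum>k\<in>J. \<kappa> k"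
    and "K2 \<equiv> \<Sum>k\<in>I - J. \<kappa> k"
    and "\<alpha> \<equiv> E * ((Ka + L) * (S * E / (1 - A * E)) + K2)"
    and "\<rho> \<equiv> E * ((Ka + L) * ((A * E + S * E) / (1 - A * E)) + Ka + 2 * KJ + K2)"
    and "\<mu> \<equiv> 1 / (1 - \<gamma> / \<beta>)"
  assumes AE1: "A * E < 1" and \<alpha>1: "\<mu> * \<alpha> < 1" and T: "\<sigma> \<le> T"
  shows "\<bar>x T\<bar> \<le> (1 + \<mu> * \<rho>) * N / (1 - \<mu> * \<alpha>) * e T"
proof -
  have \<mu>: "0 < \<mu>" "(1 - \<gamma> / \<beta>) * \<mu> = 1" using \<gamma> \<beta> by (auto simp: \<mu>_def field_simps)
  have S0: "0 \<le> S" unfolding S_def using bb0 by (rule sum_nonneg)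
  have L0: "0 \<le> L" unfolding L_def using \<kappa>0 \<tau> JI by (intro sum_nonneg mult_nonneg_nonneg) auto
  have KJ0: "0 \<le> KJ" unfolding KJ_def using \<kappa>0 JI by (intro sum_nonneg) auto
  have K20: "0 \<le> K2" unfolding K2_def using \<kappa>0 by (intro sum_nonneg) auto
  have \<alpha>0: "0 \<le> \<alpha>" unfolding \<alpha>_def using E_pos Ka0 L0 S0 AE1 K20
    by (intro mult_nonneg_nonneg add_nonneg_nonneg divide_nonneg_pos) auto
  have \<rho>0: "0 \<le> \<rho>" unfolding \<rho>_def using E_pos Ka0 L0 S0 AE1 A0 K20 KJ0
    by (intro mult_nonneg_nonneg add_nonneg_nonneg divide_nonneg_pos) auto
  obtain P0 where P0: "0 \<le> P0" "\<And>t. t \<in> {\<sigma>..T} \<Longrightarrow> \<bar>x t\<bar> \<le> P0 * e t"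
    using solution_bounded[OF T] by blast
  \<comment> \<open>Stated over the counting measure only so that the contraction lemma applies pointwise.\<close>
  have "AE t in count_space UNIV. t \<in> {\<sigma>..T} \<longrightarrow>
      \<bar>x t\<bar> \<le> (1 + \<mu> * \<rho>) * N / (1 - \<mu> * \<alpha>) * e t"
  proof (rule AE_le_affine_contraction[where ?q0.0 = P0])
    show "0 \<le> \<mu> * \<alpha>" using \<mu> \<alpha>0 by simp
    show "0 \<le> (1 + \<mu> * \<rho>) * N" using \<mu> \<rho>0 N0 by simp
    show "AE t in count_space UNIV. t \<in> {\<sigma>..T} \<longrightarrow> \<bar>x t\<bar> \<le> P0 * e t"
      using P0 by (simp add: AE_count_space)
  next
    fix P :: real
    assume "0 \<le> P" "AE t in count_space UNIV. t \<in> {\<sigma>..T} \<longrightarrow> \<bar>x t\<bar> \<le> P * e t"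
    then have P: "0 \<le> P" "\<And>t. t \<in> {\<sigma>..T} \<Longrightarrow> \<bar>x t\<bar> \<le> P * e t" by (auto simp: AE_count_space)
    define q where "q = (A * E * N + S * E * (P + N)) / (1 - A * E)"
    define r where
      "r = E * (Ka * (q + N) + (\<Sum>k\<in>J. \<kappa> k * (\<tau> k * q + 2 * N)) + (\<Sum>k\<in>I - J. \<kappa> k) * (P + N))"
    have q0: "0 \<le> q" unfolding q_def using A0 E_pos N0 S0 P(1) AE1 by simp
    have q: "AE t in lebesgue. t \<in> {\<sigma>..T} \<longrightarrow> \<bar>deriv x t\<bar> \<le> q * e t"
      using deriv_le[OF T P AE1] by (simp add: q_def S_def)
    \<comment> \<open>Separating the parts in \<open>P\<close> and \<open>N\<close> lets
      \<open>\<alpha>\<close> and \<open>\<rho>\<close> be read off as coefficients of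
      \<open>r\<close>.\<close>
    have q_eq: "q = S * E / (1 - A * E) * P + (A * E + S * E) / (1 - A * E) * N"
      unfolding q_def
      by (simp add: add_divide_distrib[symmetric]) (simp add: algebra_simps)
    have "(\<Sum>k\<in>J. \<kappa> k * (\<tau> k * q + 2 * N)) = L * q + 2 * KJ * N"
      by (simp add: L_def KJ_def sum.distrib sum_distrib_left sum_distrib_right algebra_simps)
    then have "r = E * (Ka * (q + N) + (L * q + 2 * KJ * N) + K2 * (P + N))"
      by (simp add: r_def K2_def)
    also have "\<dots> = E * ((Ka + L) * q + (Ka + 2 * KJ + K2) * N + K2 * P)" by (simp add: algebra_simps)
    also have "\<dots> = \<alpha> * P + \<rho> * N" unfolding q_eq \<alpha>_def \<rho>_def
      by (simp only: distrib_left distrib_right mult_ac add_ac)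
    finally have r: "r = \<alpha> * P + \<rho> * N" .
    have r0: "0 \<le> r" unfolding r using \<alpha>0 \<rho>0 P(1) N0 by simp
    have rem: "AE s in lebesgue. s \<in> {\<sigma>..T} \<longrightarrow>
        \<bar>deriv x s + B s * x s\<bar> \<le> B s * r * exp (- \<gamma> * (s - \<sigma>))"
      using remainder_le[OF P q0 q] unfolding r_def[symmetric] e_def by simp
    have step: "\<bar>x t\<bar> \<le> (N + \<mu> * r) * e t" if t: "t \<in> {\<sigma>..T}" for t
      unfolding e_def
    proof (rule exp_barrier[where B = B and r = r and \<beta> = \<beta>])
      show "abs_continuous_on_interval \<sigma> t x" "\<sigma> \<le> t" using x_ac t by auto
      show "AE s in lebesgue. s \<in> {\<sigma>..t} \<longrightarrow> x differentiable (at s)"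
        using x_diff by eventually_elim simp
      show "AE s in lebesgue. s \<in> {\<sigma>..t} \<longrightarrow>
          \<bar>deriv x s + B s * x s\<bar> \<le> B s * r * exp (- \<gamma> * (s - \<sigma>))"
        using rem by eventually_elim (use t in auto)
      show "\<beta> \<le> B s" if "s \<in> {\<sigma>..t}" for s using B_ge \<sigma> that by auto
      \<comment> \<open>In \<open>K = N + \<mu> * r\<close> the first summand covers the initial
        value, and \<open>\<mu> * r\<close> solves the condition on \<open>r\<close> with
        equality.\<close>
      show "r \<le> (1 - \<gamma> / \<beta>) * (N + \<mu> * r)"
      proof -
        have "0 \<le> (1 - \<gamma> / \<beta>) * N" using N0 \<gamma> \<beta> by simp
        moreover have "(1 - \<gamma> / \<beta>) * (N + \<mu> * r) = (1 - \<gamma> / \<beta>) * N + ((1 - \<gamma> / \<beta>) * \<mu>) * r"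
          by (simp add: distrib_left mult.assoc)
        ultimately show ?thesis by (simp add: \<mu>(2))
      qed
      show "\<bar>x \<sigma>\<bar> \<le> N + \<mu> * r" using x_\<sigma> \<phi>_le[of \<sigma>] \<mu>(1) r0
        by (simp add: add_increasing2)
    qed (use \<gamma> \<beta> r0 in auto)
    have "N + \<mu> * r = (1 + \<mu> * \<rho>) * N + \<mu> * \<alpha> * P" unfolding r by (simp add: algebra_simps)
    then show "AE t in count_space UNIV. t \<in> {\<sigma>..T} \<longrightarrow>
        \<bar>x t\<bar> \<le> ((1 + \<mu> * \<rho>) * N + \<mu> * \<alpha> * P) * e t"
      using step by (simp add: AE_count_space)
  qed (fact \<alpha>1 P0(1))+
  then show ?thesis using T by (simp add: AE_count_space)
qed

end

section \<open>The stability condition\<close>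

lemma ess_norm_finite_imp_AE_le:
  assumes "ess_norm S f < \<infinity>" "S \<in> sets lebesgue"
  shows "\<exists>q\<ge>0. AE t in lebesgue. t \<in> S \<longrightarrow> \<bar>f t\<bar> \<le> q"
proof -
  obtain q where q: "0 \<le> q" "ess_norm S f \<le> ereal q"
  proof (cases "ess_norm S f")
    case (real r)
    then show ?thesis by (intro that[of "max 0 r"]) auto
  \<comment> \<open>The value -\<infinity> occurs for measurable functions on null sets, such as a
    one-point interval; there the bound 0 works.\<close>
  qed (use assms that[of 0] in auto)
  have "AE t in lebesgue_on S. ereal \<bar>f t\<bar> \<le> ess_norm S f"
    unfolding ess_norm_def by (rule esssup_AE)
  then have "AE t in lebesgue_on S. \<bar>f t\<bar> \<le> q"
    by eventually_elim (use q(2) in \<open>meson ereal_less_eq(3) order_trans\<close>)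
  then show ?thesis using q(1) assms(2) by (auto simp: AE_lebesgue_on_iff)
qed

text \<open>A negative value would lie below every absolute value, so the half-line would be null,
  although it contains an interval of length 1.\<close>

lemma ess_norm_atLeast_nonneg: "0 \<le> ess_norm {c..} f"
proof (rule ccontr)
  assume "\<not> 0 \<le> ess_norm {c..} f"
  then have neg: "ess_norm {c..} f < ereal \<bar>y\<bar>" for y
    by (metis abs_ge_zero ereal_less_eq(5) not_le order_less_le_trans)
  have "AE t in lebesgue_on {c..}. ereal \<bar>f t\<bar> \<le> ess_norm {c..} f"
    unfolding ess_norm_def by (rule esssup_AE)
  then have "AE t in lebesgue_on {c..}. False"
    by eventually_elim (use neg in \<open>simp add: not_le[symmetric]\<close>)
  then have "AE t in lebesgue. t \<notin> {c..}" by (simp add: AE_lebesgue_on_iff)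
  then have "{c..} \<in> null_sets lebesgue" by (subst (asm) AE_iff_null_sets[symmetric]) auto
  then have "{c..c + 1} \<in> null_sets lebesgue" by (rule null_sets_subset) auto
  then show False by (simp add: null_sets_def)
qed

lemma ess_norm_atLeast_finite:
  assumes "ess_norm {c..} f < \<infinity>"
  obtains n where "0 \<le> n" "ess_norm {c..} f = ereal n" "AE t in lebesgue. c \<le> t \<longrightarrow> \<bar>f t\<bar> \<le> n"
proof -
  obtain n where n: "ess_norm {c..} f = ereal n"
    using assms ess_norm_atLeast_nonneg[of c f] by (cases "ess_norm {c..} f") auto
  have "AE t in lebesgue_on {c..}. ereal \<bar>f t\<bar> \<le> ess_norm {c..} f"
    unfolding ess_norm_def by (rule esssup_AE)
  then have "AE t in lebesgue. c \<le> t \<longrightarrow> \<bar>f t\<bar> \<le> n"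
    by (simp add: AE_lebesgue_on_iff n)
  then show thesis using n ess_norm_atLeast_nonneg[of c f] by (intro that[of n]) auto
qed

lemma ess_norm_finiteI:
  assumes "f \<in> borel_measurable (lebesgue_on S)" "S \<in> sets lebesgue"
    and "AE t in lebesgue. t \<in> S \<longrightarrow> \<bar>f t\<bar> \<le> q"
  shows "ess_norm S f < \<infinity>"
proof -
  have "ess_norm S f \<le> ereal q"
    unfolding ess_norm_def
    using assms by (intro esssup_I) (auto simp: AE_lebesgue_on_iff)
  then show ?thesis by (rule order_le_less_trans) simp
qed

theorem theorem5p3:
  fixes t0 a0 \<delta> \<beta> :: real
    and m :: nat
    and a g B :: "real \<Rightarrow> real"
    and b h :: "nat \<Rightarrow> real \<Rightarrow> real"
    and \<tau> :: "nat \<Rightarrow> real"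
    and J :: "nat set"
  assumes "t0 \<ge> 0" and "m \<ge> 1"
    and "a \<in> borel_measurable (lebesgue_on {0..})"
    and "g \<in> borel_measurable (lebesgue_on {0..})"
    and "\<And>k. k \<in> {1..m} \<Longrightarrow> b k \<in> borel_measurable (lebesgue_on {0..})"
    and "\<And>k. k \<in> {1..m} \<Longrightarrow> h k \<in> borel_measurable (lebesgue_on {0..})"
    and "ess_norm {0..} a < \<infinity>"
    and "\<And>k. k \<in> {1..m} \<Longrightarrow> ess_norm {0..} (b k) < \<infinity>"
    and "ess_norm {t0..} a \<le> ereal a0" and "a0 < 1"
    and "\<And>k t. k \<in> {1..m} \<Longrightarrow> t \<ge> t0 \<Longrightarrow> b k t \<ge> 0"
    and "\<And>t. t \<ge> 0 \<Longrightarrow> 0 \<le> t - g t \<and> t - g t \<le> \<delta>"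
    and "\<And>k t. k \<in> {1..m} \<Longrightarrow> t \<ge> 0 \<Longrightarrow> 0 \<le> t - h k t \<and> t - h k t \<le> \<tau> k"
    and "\<And>E. E \<in> null_sets lebesgue \<Longrightarrow> {t \<in> {0..}. g t \<in> E} \<in> null_sets lebesgue"
    and "\<beta> > 0" and "J \<subseteq> {1..m}"
    and "\<And>t. B t = (\<Sum>k\<in>J. b k t)"
    and "\<And>t. t \<ge> t0 \<Longrightarrow> B t \<ge> \<beta>"
    and "(ess_norm {t0..} (\<lambda>t. a t / B t)
            + (\<Sum>k\<in>J. ereal (\<tau> k) * ess_norm {t0..} (\<lambda>t. b k t / B t)))
          * ((\<Sum>k = 1..m. ess_norm {t0..} (b k)) / (1 - ess_norm {t0..} a))
          + (\<Sum>k\<in>{1..m} - J. ess_norm {t0..} (\<lambda>t. b k t / B t)) < 1"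
  shows "exponentially_stable t0 m a g b h"
proof -
  have meas: "f \<in> borel_measurable (lebesgue_on {t0..})"
    if "f \<in> borel_measurable (lebesgue_on {0..})" for f :: "real \<Rightarrow> real"
    using that by (rule measurable_restrict_mono) (use assms(1) in auto)
  have B_meas: "B \<in> borel_measurable (lebesgue_on {t0..})"
    unfolding assms(17) by (intro borel_measurable_sum meas assms(5)) (use assms(16) in auto)
  have norm_b: "ess_norm {t0..} (b k) < \<infinity>" if k: "k \<in> {1..m}" for k
  proof -
    obtain q where q: "AE t in lebesgue. t \<in> {0..} \<longrightarrow> \<bar>b k t\<bar> \<le> q"
      using ess_norm_finite_imp_AE_le[OF assms(8)[OF k]] by auto
    show ?thesis
    proof (rule ess_norm_finiteI[OF meas[OF assms(5)[OF k]]])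
      show "AE t in lebesgue. t \<in> {t0..} \<longrightarrow> \<bar>b k t\<bar> \<le> q"
        using q by eventually_elim (use assms(1) in auto)
    qed simp
  qed
  \<comment> \<open>Since \<open>B\<close> stays above \<open>\<beta> > 0\<close>, the quotients are
    essentially bounded, and every norm in the stability condition is a real number.\<close>
  have norm_div: "ess_norm {t0..} (\<lambda>t. f t / B t) < \<infinity>"
    if f: "f \<in> borel_measurable (lebesgue_on {0..})" "ess_norm {t0..} f < \<infinity>" for f
  proof -
    obtain q where q: "AE t in lebesgue. t \<in> {t0..} \<longrightarrow> \<bar>f t\<bar> \<le> q"
      using ess_norm_finite_imp_AE_le[OF f(2)] by auto
    show ?thesis
    proof (rule ess_norm_finiteI)
      show "(\<lambda>t. f t / B t) \<in> borel_measurable (lebesgue_on {t0..})"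
        by (intro borel_measurable_divide meas f B_meas)
      show "AE t in lebesgue. t \<in> {t0..} \<longrightarrow> \<bar>f t / B t\<bar> \<le> q / \<beta>"
        using q
      proof eventually_elim
        case (elim t)
        show ?case
        proof
          assume t: "t \<in> {t0..}"
          then have "\<beta> \<le> B t" "\<bar>f t\<bar> \<le> q" using assms(18) elim by auto
          then show "\<bar>f t / B t\<bar> \<le> q / \<beta>"
            using assms(15) by (auto simp: abs_divide intro!: frac_le)
        qed
      qed
    qed simp
  qed
  have AE_div: "AE t in lebesgue. t0 \<le> t \<longrightarrow> \<bar>f t\<bar> \<le> n * B t"
    if "AE t in lebesgue. t0 \<le> t \<longrightarrow> \<bar>f t / B t\<bar> \<le> n" for f n
    using that
  proof eventually_elim
    case (elim t)
    show ?case
    proof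
      assume t: "t0 \<le> t"
      then have "0 < B t" using assms(15,18) by (meson less_le_trans)
      then show "\<bar>f t\<bar> \<le> n * B t" using elim t by (simp add: abs_divide pos_divide_le_eq)
    qed
  qed
  have norm_a: "ess_norm {t0..} a < \<infinity>" using assms(9) by (rule order_le_less_trans) simp
  obtain A where A: "0 \<le> A" "ess_norm {t0..} a = ereal A" "AE t in lebesgue. t0 \<le> t \<longrightarrow> \<bar>a t\<bar> \<le> A"
    using ess_norm_atLeast_finite[OF norm_a] .
  have A1: "A < 1" using A(2) assms(9,10) by simp
  obtain Ka where Ka: "0 \<le> Ka" "ess_norm {t0..} (\<lambda>t. a t / B t) = ereal Ka"
      "AE t in lebesgue. t0 \<le> t \<longrightarrow> \<bar>a t / B t\<bar> \<le> Ka"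
    using ess_norm_atLeast_finite[OF norm_div[OF assms(3) norm_a]] .
  have "\<forall>k\<in>{1..m}. \<exists>n. 0 \<le> n \<and> ess_norm {t0..} (b k) = ereal n \<and>
      (AE t in lebesgue. t0 \<le> t \<longrightarrow> \<bar>b k t\<bar> \<le> n)"
    by (intro ballI) (rule ess_norm_atLeast_finite[OF norm_b], assumption, blast)
  from bchoice[OF this] obtain bb where bb: "\<And>k. k \<in> {1..m} \<Longrightarrow> 0 \<le> bb k"
      "\<And>k. k \<in> {1..m} \<Longrightarrow> ess_norm {t0..} (b k) = ereal (bb k)"
      "\<And>k. k \<in> {1..m} \<Longrightarrow> AE t in lebesgue. t0 \<le> t \<longrightarrow> \<bar>b k t\<bar> \<le> bb k"
    by blast
  have "\<forall>k\<in>{1..m}. \<exists>n. 0 \<le> n \<and> ess_norm {t0..} (\<lambda>t. b k t / B t) = ereal n \<and>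
      (AE t in lebesgue. t0 \<le> t \<longrightarrow> \<bar>b k t / B t\<bar> \<le> n)"
    by (intro ballI) (rule ess_norm_atLeast_finite[OF norm_div[OF assms(5) norm_b]], assumption+, blast)
  from bchoice[OF this] obtain \<kappa> where \<kappa>: "\<And>k. k \<in> {1..m} \<Longrightarrow> 0 \<le> \<kappa> k"
      "\<And>k. k \<in> {1..m} \<Longrightarrow> ess_norm {t0..} (\<lambda>t. b k t / B t) = ereal (\<kappa> k)"
      "\<And>k. k \<in> {1..m} \<Longrightarrow> AE t in lebesgue. t0 \<le> t \<longrightarrow> \<bar>b k t / B t\<bar> \<le> \<kappa> k"
    by blast
  define S L KJ K2 where "S = (\<Sum>k\<in>{1..m}. bb k)" and "L = (\<Sum>k\<in>J. \<tau> k * \<kappa> k)"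
    and "KJ = (\<Sum>k\<in>J. \<kappa> k)" and "K2 = (\<Sum>k\<in>{1..m} - J. \<kappa> k)"
  have "(\<Sum>k\<in>J. ereal (\<tau> k) * ess_norm {t0..} (\<lambda>t. b k t / B t)) = ereal L"
  proof -
    have "(\<Sum>k\<in>J. ereal (\<tau> k) * ess_norm {t0..} (\<lambda>t. b k t / B t)) = (\<Sum>k\<in>J. ereal (\<tau> k * \<kappa> k))"
      using assms(16) \<kappa>(2) by (intro sum.cong) auto
    then show ?thesis by (simp add: L_def)
  qed
  moreover have "(\<Sum>k = 1..m. ess_norm {t0..} (b k)) = ereal S"
    using bb(2) by (simp add: S_def)
  moreover have "(\<Sum>k\<in>{1..m} - J. ess_norm {t0..} (\<lambda>t. b k t / B t)) = ereal K2"
    using \<kappa>(2) by (simp add: K2_def)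
  ultimately have "(ereal Ka + ereal L) * (ereal S / (1 - ereal A)) + ereal K2 < 1"
    using assms(19) by (simp only: A(2) Ka(2))
  \<comment> \<open>All norms are finite and \<open>1 - A\<close> is positive, so the condition
    passes from extended reals to reals.\<close>
  then have small: "(Ka + L) * (S / (1 - A)) + K2 < 1"
    using A1 by (simp add: one_ereal_def)
  have \<tau>0: "0 \<le> \<tau> k" if "k \<in> {1..m}" for k using assms(13)[OF that, of 0] by simp
  \<comment> \<open>The delay bounds are nonnegative, so their sum dominates each of them.\<close>
  define d where "d = \<delta> + (\<Sum>k\<in>{1..m}. \<tau> k)"
  have \<delta>d: "\<delta> \<le> d" unfolding d_def using sum_nonneg[of "{1..m}" \<tau>, OF \<tau>0] by simp
  have \<tau>d: "\<tau> k \<le> d" if "k \<in> {1..m}" for k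
  proof -
    have "\<tau> k \<le> (\<Sum>k\<in>{1..m}. \<tau> k)" by (rule member_le_sum[OF that]) (use \<tau>0 in auto)
    then show ?thesis using assms(12)[of 0] by (simp add: d_def)
  qed
  interpret neutral_delay t0 A Ka \<beta> d a g B b h \<tau> \<kappa> bb "{1..m}" J
  proof
    show "AE t in lebesgue. t0 \<le> t \<longrightarrow> \<bar>a t\<bar> \<le> Ka * B t" by (rule AE_div[OF Ka(3)])
    show "AE t in lebesgue. t0 \<le> t \<longrightarrow> \<bar>b k t\<bar> \<le> \<kappa> k * B t" if "k \<in> {1..m}" for k
      by (rule AE_div[OF \<kappa>(3)[OF that]])
    show "g t \<le> t \<and> t - g t \<le> d" if "0 \<le> t" for t using assms(12)[OF that] \<delta>d by auto
    show "h k t \<le> t \<and> t - h k t \<le> \<tau> k" if "k \<in> {1..m}" "0 \<le> t" for k t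
      using assms(13)[OF that] by auto
  qed (use assms A Ka bb \<kappa> \<tau>0 \<tau>d in \<open>simp_all\<close>)
  define \<mu> where "\<mu> \<gamma> = 1 / (1 - \<gamma> / \<beta>)" for \<gamma>
  define \<alpha> where "\<alpha> E = E * ((Ka + L) * (S * E / (1 - A * E)) + K2)" for E
  define \<rho> where "\<rho> E = E * ((Ka + L) * ((A * E + S * E) / (1 - A * E)) + Ka + 2 * KJ + K2)" for E
  have E_lim: "((\<lambda>\<gamma>. exp (\<gamma> * d)) \<longlongrightarrow> 1) (at_right 0)"
    by (auto intro!: tendsto_eq_intros)
  have \<mu>_lim: "(\<mu> \<longlongrightarrow> 1) (at_right 0)"
    unfolding \<mu>_def using assms(15) by (auto intro!: tendsto_eq_intros)
  \<comment> \<open>As \<open>\<gamma>\<close> tends to 0, the contraction factor tends to the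
    left-hand side of the stability condition, so it is below 1 for small \<open>\<gamma>\<close>.
    This fixes the decay rate before \<open>\<sigma>\<close> and the initial data are
    chosen.\<close>
  have "((\<lambda>\<gamma>. \<mu> \<gamma> * \<alpha> (exp (\<gamma> * d))) \<longlongrightarrow>
      1 * (1 * ((Ka + L) * (S * 1 / (1 - A * 1)) + K2))) (at_right 0)"
    unfolding \<alpha>_def using A1 by (intro tendsto_intros E_lim \<mu>_lim) auto
  then have "\<forall>\<^sub>F \<gamma> in at_right 0. \<mu> \<gamma> * \<alpha> (exp (\<gamma> * d)) < 1"
    by (rule order_tendstoD) (use small in simp)
  moreover have "((\<lambda>\<gamma>. A * exp (\<gamma> * d)) \<longlongrightarrow> A * 1) (at_right 0)"
    by (intro tendsto_intros E_lim)
  then have "\<forall>\<^sub>F \<gamma> in at_right 0. A * exp (\<gamma> * d) < 1"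
    by (rule order_tendstoD) (use A1 in simp)
  moreover have "\<forall>\<^sub>F \<gamma> in at_right (0::real). 0 < \<gamma> \<and> \<gamma> < \<beta>"
    using eventually_at_right_real[OF assms(15)] by eventually_elim simp
  ultimately have "\<forall>\<^sub>F \<gamma> in at_right 0. \<mu> \<gamma> * \<alpha> (exp (\<gamma> * d)) < 1 \<and> A * exp (\<gamma> * d) < 1 \<and> 0 < \<gamma> \<and> \<gamma> < \<beta>"
    by eventually_elim simp
  then obtain \<gamma> where \<gamma>: "\<mu> \<gamma> * \<alpha> (exp (\<gamma> * d)) < 1" "A * exp (\<gamma> * d) < 1" "0 < \<gamma>" "\<gamma> < \<beta>"
    using eventually_happens'[OF trivial_limit_at_right_real] by blast
  define E where "E = exp (\<gamma> * d)"
  define M where "M = (1 + \<mu> \<gamma> * \<rho> E) / (1 - \<mu> \<gamma> * \<alpha> E)"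
  \<comment> \<open>Using \<open>\<bar>M\<bar> + 1\<close> gives a positive constant without
    examining the sign of \<open>M\<close>.\<close>
  have "\<bar>x t\<bar> \<le> (\<bar>M\<bar> + 1) * exp (- \<gamma> * (t - \<sigma>)) *
      (SUP s\<in>{..\<sigma>}. \<bar>\<phi> s\<bar> + (if s < \<sigma> then \<bar>\<psi> s\<bar> else 0))"
    if \<sigma>: "t0 \<le> \<sigma>" and ini: "admissible_initial_data \<sigma> \<phi> \<psi>"
      and sol: "is_solution m a g b h \<sigma> \<phi> \<psi> x" and t: "\<sigma> \<le> t" for \<sigma> \<phi> \<psi> x t
  proof -
    let ?f = "\<lambda>s. \<bar>\<phi> s\<bar> + (if s < \<sigma> then \<bar>\<psi> s\<bar> else 0)"
    define N where "N = (SUP s\<in>{..\<sigma>}. ?f s)"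
    obtain c1 c2 where c: "\<And>s. s \<le> \<sigma> \<Longrightarrow> \<bar>\<phi> s\<bar> \<le> c1" "\<And>s. s < \<sigma> \<Longrightarrow> \<bar>\<psi> s\<bar> \<le> c2"
      using ini unfolding admissible_initial_data_def bounded_iff by auto
    \<comment> \<open>Boundedness of the data makes the real supremum a genuine upper bound.\<close>
    have bdd: "bdd_above (?f ` {..\<sigma>})"
    proof (rule bdd_aboveI2)
      show "?f s \<le> c1 + \<bar>c2\<bar>" if "s \<in> {..\<sigma>}" for s
        using c(1)[of s] c(2)[of s] that by auto
    qed
    have fN: "?f s \<le> N" if "s \<le> \<sigma>" for s
      unfolding N_def by (rule cSUP_upper[OF _ bdd]) (use that in simp)
    have N0: "0 \<le> N" using fN[of \<sigma>] by simp
    interpret S: neutral_delay_solution t0 A Ka \<beta> d a g B b h \<tau> \<kappa> bb "{1..m}" J \<sigma> N \<gamma> E \<phi> \<psi> x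
      "\<lambda>t. exp (- \<gamma> * (t - \<sigma>))" "\<lambda>t. if t \<le> \<sigma> then \<phi> t else x t" "\<lambda>t. if t < \<sigma> then \<psi> t else deriv x t"
    proof
      show "\<bar>\<phi> s\<bar> \<le> N" if "s \<le> \<sigma>" for s using fN[OF that] by (simp split: if_splits)
      show "\<bar>\<psi> s\<bar> \<le> N" if "s < \<sigma>" for s using fN[of s] that by simp
      show "\<exists>q\<ge>0. AE t in lebesgue. t \<in> {\<sigma>..c} \<longrightarrow> \<bar>deriv x t\<bar> \<le> q" if "\<sigma> \<le> c" for c
        using sol that by (intro ess_norm_finite_imp_AE_le) (auto simp: is_solution_def)
    qed (use sol \<sigma> N0 \<gamma> in \<open>simp_all add: is_solution_def AE_lebesgue_on_iff E_def\<close>)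
    have "\<bar>x t\<bar> \<le> (1 + \<mu> \<gamma> * \<rho> E) * N / (1 - \<mu> \<gamma> * \<alpha> E) * exp (- \<gamma> * (t - \<sigma>))"
      using S.solution_decay[OF _ _ t] \<gamma>(1,2)
      unfolding \<mu>_def \<alpha>_def \<rho>_def S_def L_def KJ_def K2_def E_def by simp
    also have "\<dots> = M * (exp (- \<gamma> * (t - \<sigma>)) * N)" by (simp add: M_def)
    also have "\<dots> \<le> (\<bar>M\<bar> + 1) * (exp (- \<gamma> * (t - \<sigma>)) * N)"
      using N0 by (intro mult_right_mono) auto
    finally show ?thesis by (simp add: N_def mult.assoc)
  qed
  then show ?thesis
    unfolding exponentially_stable_def
    by (intro exI[of _ "\<bar>M\<bar> + 1"] exI[of _ \<gamma>]) (use \<gamma>(3) in auto)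
qed

end
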